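(* Let $\Phi$ be the real affine root system of type $E_6^{(2)}$. Then $\Psi\subseteq\Phi$ is a maximal closed subroot system with a proper semi-closed gradient subroot system if and only if there exists a $\mathbb Z$-linear function $p:\mathcal D_4\to\mathbb Z$ such that $\Psi=\Psi_p(E_6^{(2)})$ and exactly two of $p_{\epsilon_1},p_{\epsilon_2},p_{\epsilon_3},p_{\epsilon_4}$ are even. The type of $\Psi_p(E_6^{(2)})$ is $C_4^{(1)}$.
   Context: $\epsilon_1,\dots,\epsilon_4$ are orthonormal and $\delta$ is a vector linearly independent of them with $(\delta,\cdot)=0$. $$\mathring\Phi=\{\pm\epsilon_i,\ \pm\epsilon_i\pm\epsilon_j,\ \tfrac12(\lambda_1\epsilon_1+\lambda_2\epsilon_2+\lambda_3\epsilon_3+\lambda_4\epsilon_4):\lambda_i=\pm1,\ 1\le i\ne j\le4\}$$ (type $F_4$; long roots $\pm\epsilon_i\pm\epsilon_j$, the others short), and $$\Phi=\{\pm\epsilon_i+r\delta,\ \pm\epsilon_i\pm\epsilon_j+2r\delta,\ \tfrac12(\lambda_1\epsilon_1+\lambda_2\epsilon_2+\lambda_3\epsilon_3+\lambda_4\epsilon_4)+r\delta:\lambda_i=\pm1,\ 1\le i\ne j\le4,\ r\in\mathbb Z\}.$$ $\mathcal D_4=\{\pm\epsilon_i,\tfrac12\sum_j\lambda_j\epsilon_j:\lambda_j=\pm1\}$ is the set of short roots of $\mathring\Phi$ (a root system of type $D_4$). A function $p:\mathcal D_4\to\mathbb Z$, $\alpha\mapsto p_\alpha$, is $\mathbb Z$-linear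 if it is the restriction of an additive homomorphism from the lattice spanned by $\mathcal D_4$. For such $p$ with exactly two $p_{\epsilon_i}$ even and the other two odd, $$\Psi_p(E_6^{(2)})=\{\alpha+(p_\alpha+2r)\delta:\alpha\in\mathcal D_4,r\in\mathbb Z\}\cup\{\pm\epsilon_i\pm\epsilon_j+2r\delta:i\neq j,\ p_{\epsilon_i}+p_{\epsilon_j}\in2\mathbb Z,\ r\in\mathbb Z\}.$$ With $\langle\beta,\alpha^\vee\rangle=2(\beta,\alpha)/(\alpha,\alpha)$ and $\mathbf s_\alpha(\beta)=\beta-\langle\beta,\alpha^\vee\rangle\alpha$, a non-empty subset $\Psi$ of $R$ ($R=\Phi$ or $\mathring\Phi$) is a subroot system if $\mathbf s_\alpha(\beta)\in\Psi$ for all $\alpha,\beta\in\Psi$; it is closed if $\alpha,\beta\in\Psi$, $\alpha+\beta\in R$ imply $\alpha+\beta\in\Psi$. A maximal closed subroot system of $R$ is a proper closed subroot system $\Psi$ such that $\Psi\subseteq\Delta\subsetneq R$ with $\Delta$ a closed subroot system implies $\Delta=\Psi$. The gradient is $\mathrm{Gr}(\Psi)=\{\alpha\in\mathring\Phi:\alpha+r\delta\in\Psi\text{ for some }r\}$. A subroot system $\mathring\Psi$ of $\mathring\Phi$ is semi-closed if it is not closed in $\mathring\Phi$ and, whenever $\alpha,\beta\in\mathring\Psi$ satisfy $\alpha+\beta\in\mathring\Phi\setminus\mathring\Psi$, the roots $\alpha,\beta$ are short and $\alpha+\beta$ is long. Type: an irreducible subroot system $\Psi$ is of type $X_k^{(t)}$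 if there is a linear isomorphism from the real span of $\Psi$ onto the real span of the real affine root system of type $X_k^{(t)}$ mapping $\Psi$ onto it and preserving the integers $\langle\beta,\alpha^\vee\rangle$. The real roots of type $C_4^{(1)}$ are $\{\alpha+r\delta:\alpha\in C_4,r\in\mathbb Z\}$. *)

theory Defs
  imports "HOL-Analysis.Analysis"
begin

section \<open>Root systems with respect to a symmetric bilinear form\<close>

definition cartan_int :: "('v::real_vector \<Rightarrow> 'v \<Rightarrow> real) \<Rightarrow> 'v \<Rightarrow> 'v \<Rightarrow> real" where
  "cartan_int B \<beta> \<alpha> = 2 * B \<beta> \<alpha> / B \<alpha> \<alpha>"

definition refl_root :: "('v::real_vector \<Rightarrow> 'v \<Rightarrow> real) \<Rightarrow> 'v \<Rightarrow> 'v \<Rightarrow> 'v" where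
  "refl_root B \<alpha> \<beta> = \<beta> - cartan_int B \<beta> \<alpha> *\<^sub>R \<alpha>"

definition subroot_system ::
  "('v::real_vector \<Rightarrow> 'v \<Rightarrow> real) \<Rightarrow> 'v set \<Rightarrow> 'v set \<Rightarrow> bool" where
  "subroot_system B R \<Psi> \<longleftrightarrow>
     \<Psi> \<noteq> {} \<and> \<Psi> \<subseteq> R \<and> (\<forall>\<alpha>\<in>\<Psi>. \<forall>\<beta>\<in>\<Psi>. refl_root B \<alpha> \<beta> \<in> \<Psi>)"

definition root_closed :: "'v::real_vector set \<Rightarrow> 'v set \<Rightarrow> bool" where
  "root_closed R \<Psi> \<longleftrightarrow> (\<forall>\<alpha>\<in>\<Psi>. \<forall>\<beta>\<in>\<Psi>. \<alpha> + \<beta> \<in> R \<longrightarrow> \<alpha> + \<beta> \<in> \<Psi>)"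

definition closed_subroot_system ::
  "('v::real_vector \<Rightarrow> 'v \<Rightarrow> real) \<Rightarrow> 'v set \<Rightarrow> 'v set \<Rightarrow> bool" where
  "closed_subroot_system B R \<Psi> \<longleftrightarrow> subroot_system B R \<Psi> \<and> root_closed R \<Psi>"

definition maximal_closed_subroot_system ::
  "('v::real_vector \<Rightarrow> 'v \<Rightarrow> real) \<Rightarrow> 'v set \<Rightarrow> 'v set \<Rightarrow> bool" where
  "maximal_closed_subroot_system B R \<Psi> \<longleftrightarrow>
     closed_subroot_system B R \<Psi> \<and> \<Psi> \<noteq> R \<and>
     (\<forall>\<Delta>. closed_subroot_system B R \<Delta> \<and> \<Psi> \<subseteq> \<Delta> \<and> \<Delta> \<subset> R \<longrightarrow> \<Delta> = \<Psi>)"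

definition irreducible_roots ::
  "('v::real_vector \<Rightarrow> 'v \<Rightarrow> real) \<Rightarrow> 'v set \<Rightarrow> bool" where
  "irreducible_roots B \<Psi> \<longleftrightarrow>
     \<not> (\<exists>\<Psi>1 \<Psi>2. \<Psi>1 \<noteq> {} \<and> \<Psi>2 \<noteq> {} \<and> \<Psi>1 \<inter> \<Psi>2 = {} \<and> \<Psi> = \<Psi>1 \<union> \<Psi>2 \<and>
          (\<forall>\<alpha>\<in>\<Psi>1. \<forall>\<beta>\<in>\<Psi>2. B \<alpha> \<beta> = 0))"

text \<open>\<open>X\<close> is a realisation, in the same space, of the root system whose type is meant.
  A linear isomorphism between the spans is the restriction of some linear map on the
  whole space, so \<open>f\<close> may be taken to be defined everywhere.\<close>

definition has_type ::
  "('v::real_vector \<Rightarrow> 'v \<Rightarrow> real) \<Rightarrow> 'v set \<Rightarrow> 'v set \<Rightarrow> 'v set \<Rightarrow> bool" where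
  "has_type B R \<Psi> X \<longleftrightarrow>
     subroot_system B R \<Psi> \<and> irreducible_roots B \<Psi> \<and>
     (\<exists>f. linear f \<and> bij_betw f (span \<Psi>) (span X) \<and> f ` \<Psi> = X \<and>
        (\<forall>\<alpha>\<in>\<Psi>. \<forall>\<beta>\<in>\<Psi>. cartan_int B (f \<beta>) (f \<alpha>) = cartan_int B \<beta> \<alpha>))"


section \<open>The finite system of type \<open>F\<^sub>4\<close>\<close>

definition affine_frame ::
  "('v::real_vector \<Rightarrow> 'v \<Rightarrow> real) \<Rightarrow> (4 \<Rightarrow> 'v) \<Rightarrow> 'v \<Rightarrow> bool" where
  "affine_frame B \<epsilon> \<delta> \<longleftrightarrow>
     bilinear B \<and> (\<forall>x y. B x y = B y x) \<and>
     (\<forall>i j. B (\<epsilon> i) (\<epsilon> j) = (if i = j then 1 else 0)) \<and>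
     \<delta> \<notin> span (range \<epsilon>) \<and> (\<forall>x. B \<delta> x = 0)"

definition F4_short :: "(4 \<Rightarrow> 'v::real_vector) \<Rightarrow> 'v set" where
  "F4_short \<epsilon> =
     {s *\<^sub>R \<epsilon> i | s i. s \<in> {1, -1}} \<union>
     {(1/2) *\<^sub>R (\<Sum>i\<in>UNIV. l i *\<^sub>R \<epsilon> i) | l. \<forall>i. l i \<in> {1, -1}}"

definition F4_long :: "(4 \<Rightarrow> 'v::real_vector) \<Rightarrow> 'v set" where
  "F4_long \<epsilon> =
     {s *\<^sub>R \<epsilon> i + t *\<^sub>R \<epsilon> j | s t i j. s \<in> {1, -1} \<and> t \<in> {1, -1} \<and> i \<noteq> j}"

definition F4_roots :: "(4 \<Rightarrow> 'v::real_vector) \<Rightarrow> 'v set" where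
  "F4_roots \<epsilon> = F4_short \<epsilon> \<union> F4_long \<epsilon>"

definition semi_closed ::
  "('v::real_vector \<Rightarrow> 'v \<Rightarrow> real) \<Rightarrow> (4 \<Rightarrow> 'v) \<Rightarrow> 'v set \<Rightarrow> bool" where
  "semi_closed B \<epsilon> \<Psi> \<longleftrightarrow>
     subroot_system B (F4_roots \<epsilon>) \<Psi> \<and> \<not> root_closed (F4_roots \<epsilon>) \<Psi> \<and>
     (\<forall>\<alpha>\<in>\<Psi>. \<forall>\<beta>\<in>\<Psi>. \<alpha> + \<beta> \<in> F4_roots \<epsilon> - \<Psi> \<longrightarrow>
        \<alpha> \<in> F4_short \<epsilon> \<and> \<beta> \<in> F4_short \<epsilon> \<and> \<alpha> + \<beta> \<in> F4_long \<epsilon>)"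


section \<open>The real affine root systems of types \<open>E\<^sub>6\<^sup>(\<^sup>2\<^sup>)\<close> and \<open>C\<^sub>4\<^sup>(\<^sup>1\<^sup>)\<close>\<close>

definition E62_roots :: "(4 \<Rightarrow> 'v::real_vector) \<Rightarrow> 'v \<Rightarrow> 'v set" where
  "E62_roots \<epsilon> \<delta> =
     {\<alpha> + of_int r *\<^sub>R \<delta> | \<alpha> r. \<alpha> \<in> F4_short \<epsilon>} \<union>
     {\<alpha> + of_int (2 * r) *\<^sub>R \<delta> | \<alpha> r. \<alpha> \<in> F4_long \<epsilon>}"

definition gradient :: "(4 \<Rightarrow> 'v::real_vector) \<Rightarrow> 'v \<Rightarrow> 'v set \<Rightarrow> 'v set" where
  "gradient \<epsilon> \<delta> \<Psi> = {\<alpha> \<in> F4_roots \<epsilon>. \<exists>r::int. \<alpha> + of_int r *\<^sub>R \<delta> \<in> \<Psi>}"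

definition C4_roots :: "(4 \<Rightarrow> 'v::real_vector) \<Rightarrow> 'v set" where
  "C4_roots \<epsilon> =
     {s *\<^sub>R \<epsilon> i + t *\<^sub>R \<epsilon> j | s t i j. s \<in> {1, -1} \<and> t \<in> {1, -1} \<and> i \<noteq> j} \<union>
     {(2 * s) *\<^sub>R \<epsilon> i | s i. s \<in> {1, -1}}"

definition C41_roots :: "(4 \<Rightarrow> 'v::real_vector) \<Rightarrow> 'v \<Rightarrow> 'v set" where
  "C41_roots \<epsilon> \<delta> = {\<alpha> + of_int r *\<^sub>R \<delta> | \<alpha> r. \<alpha> \<in> C4_roots \<epsilon>}"


section \<open>The subsets \<open>\<Psi>\<^sub>p\<close>\<close>

definition int_lattice :: "'v::real_vector set \<Rightarrow> 'v set" where
  "int_lattice S = {(\<Sum>\<alpha>\<in>S. of_int (n \<alpha>) *\<^sub>R \<alpha>) | n :: 'v \<Rightarrow> int. True}"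

text \<open>A function on the short roots is encoded as a total function \<open>p\<close>, whose values
  elsewhere are irrelevant both here and in \<open>Psi_p\<close>.\<close>

definition Z_linear :: "(4 \<Rightarrow> 'v::real_vector) \<Rightarrow> ('v \<Rightarrow> int) \<Rightarrow> bool" where
  "Z_linear \<epsilon> p \<longleftrightarrow>
     (\<exists>h :: 'v \<Rightarrow> int.
        (\<forall>x\<in>int_lattice (F4_short \<epsilon>). \<forall>y\<in>int_lattice (F4_short \<epsilon>). h (x + y) = h x + h y) \<and>
        (\<forall>\<alpha>\<in>F4_short \<epsilon>. p \<alpha> = h \<alpha>))"

definition exactly_two_even :: "(4 \<Rightarrow> 'v::real_vector) \<Rightarrow> ('v \<Rightarrow> int) \<Rightarrow> bool" where
  "exactly_two_even \<epsilon> p \<longleftrightarrow> card {i. even (p (\<epsilon> i))} = 2"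

definition Psi_p :: "(4 \<Rightarrow> 'v::real_vector) \<Rightarrow> 'v \<Rightarrow> ('v \<Rightarrow> int) \<Rightarrow> 'v set" where
  "Psi_p \<epsilon> \<delta> p =
     {\<alpha> + of_int (p \<alpha> + 2 * r) *\<^sub>R \<delta> | \<alpha> r. \<alpha> \<in> F4_short \<epsilon>} \<union>
     {s *\<^sub>R \<epsilon> i + t *\<^sub>R \<epsilon> j + of_int (2 * r) *\<^sub>R \<delta> | s t i j r.
        s \<in> {1, -1} \<and> t \<in> {1, -1} \<and> i \<noteq> j \<and> even (p (\<epsilon> i) + p (\<epsilon> j))}"

end

theory Submission
  imports Defs
begin

text \<open>
  Everything takes place in the lattice \<open>L\<close> of Hurwitz quaternions, spanned by the short roots.
  The short roots are its vectors of norm 1 and the long roots its vectors of norm 2, so sums and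
  reflections of roots are recognised by computing norms, without listing the 48 roots.

  All the closed subroot systems that matter are cut out by a parity condition: for a vector \<open>w\<close>
  with integral products with the short roots and an integer \<open>c\<close>, the roots \<open>x + r\<delta>\<close> with
  \<open>(x, w) + c r\<close> even form a closed subroot system, as reflections and sums are integral
  combinations. For \<open>c = 1\<close> this is \<open>\<Psi>\<^sub>p\<close>, where \<open>p x = (x, w)\<close>
  (\<open>Psi_p_eq_parity_roots\<close>): a \<open>\<int>\<close>-linear function on the short roots is the same thing as such
  a vector \<open>w\<close>. Exactly two of the \<open>p (\<epsilon> i)\<close> are even if and only if \<open>p\<close> is odd on some long
  root, and it is precisely those long roots that the gradient of \<open>\<Psi>\<^sub>p\<close> lacks.

  \<open>\<Psi>\<^sub>p\<close> is maximal (\<open>parity_roots_maximal\<close>): a closed system that contains it and one more root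
  contains a short root with a shift of the wrong parity; adding short roots of \<open>\<Psi>\<^sub>p\<close>
  spreads the wrong shift over all short roots, since these form a connected graph, and sums of
  short roots then give all the long ones.

  Conversely, let \<open>\<Psi>\<close> be maximal with a proper semi-closed gradient \<open>G\<close>. If \<open>G\<close> lacks a short
  root, there is a \<open>w\<close> that has even products with all of \<open>G\<close> but not with all short roots
  (\<open>semi_closed_obstruction\<close>). Then \<open>\<Psi>\<close> lies in the proper closed system given by \<open>w\<close> and
  \<open>c = 0\<close>, so it equals that system, whose gradient is closed: a contradiction. So \<open>G\<close> contains
  all short roots. Choosing shifts at a basis of \<open>L\<close> yields a \<open>w\<close> with \<open>x + (x, w)\<delta> \<in> \<Psi>\<close> for every
  short \<open>x\<close>, because all other short roots arise by adding short roots. If some root of \<open>\<Psi>\<close>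
  violated the parity condition for \<open>w\<close> and \<open>c = 1\<close>, spreading it would make \<open>G\<close> the whole of
  \<open>F\<^sub>4\<close>; so \<open>\<Psi>\<close> lies in, and by maximality equals, the system \<open>\<Psi>\<^sub>p\<close> of \<open>w\<close>.

  For the type, say \<open>p\<close> is even at \<open>\<epsilon> i, \<epsilon> j\<close> and odd at \<open>\<epsilon> k, \<epsilon> l\<close>. The similarity of ratio
  \<open>\<surd>2\<close> that turns the planes of \<open>\<epsilon> i, \<epsilon> j\<close> and of \<open>\<epsilon> k, \<epsilon> l\<close> by an eighth of a turn, up to
  a reflection, maps the gradient of \<open>\<Psi>\<^sub>p\<close> onto \<open>C\<^sub>4\<close>. Together with
  \<open>r \<mapsto> (r - p x) / 2\<close> on the coefficient of \<open>\<delta>\<close> it maps \<open>\<Psi>\<^sub>p\<close> onto \<open>C\<^sub>4\<^sup>(\<^sup>1\<^sup>)\<close>.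
\<close>

section \<open>Integers, halves and sums of squares\<close>

lemma half_not_Ints: "(1/2::real) \<notin> \<int>" "(-1/2::real) \<notin> \<int>"
proof -
  have "real_of_int (2 * k) \<noteq> of_int 1" "real_of_int (-1) \<noteq> of_int (2 * k)" for k
    unfolding of_int_eq_iff by presburger+
  then have "1/2 \<noteq> real_of_int k" "-1/2 \<noteq> real_of_int k" for k by (simp_all add: field_simps)
  then show "(1/2::real) \<notin> \<int>" "(-1/2::real) \<notin> \<int>" by (metis Ints_cases)+
qed

lemma even_iff_half_Ints: "even n \<longleftrightarrow> of_int n / (2::real) \<in> \<int>"
proof
  assume "even n"
  then obtain k where "n = 2 * k" by blast
  then show "of_int n / (2::real) \<in> \<int>" by simp
next
  assume "of_int n / (2::real) \<in> \<int>"
  then obtain k where "of_int n / (2::real) = of_int k" by (auto elim: Ints_cases)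
  then have "real_of_int n = of_int (2 * k)" by simp
  then have "n = 2 * k" by (simp only: of_int_eq_iff)
  then show "even n" by simp
qed

lemma floor_minus_1 [simp]: "\<lfloor>- 1 :: real\<rfloor> = -1"
  by (metis floor_of_int of_int_1 of_int_minus)

lemma Ints_bounded:
  fixes r :: real
  assumes "r \<in> \<int>" "-3 < r" "r < 3"
  shows "r = -2 \<or> r = -1 \<or> r = 0 \<or> r = 1 \<or> r = 2"
proof -
  obtain k where k: "r = of_int k" using assms(1) by (auto elim: Ints_cases)
  have "k = -2 \<or> k = -1 \<or> k = 0 \<or> k = 1 \<or> k = 2" using assms(2,3) unfolding k by linarith
  then show ?thesis unfolding k by auto
qed

lemma int_square_cases:
  fixes a :: int
  assumes "a * a \<le> 2"
  shows "a = 0 \<or> a = 1 \<or> a = -1"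
proof -
  have "\<bar>a\<bar> < 2"
  proof (rule ccontr)
    assume "\<not> \<bar>a\<bar> < 2"
    then have "2 * 2 \<le> \<bar>a\<bar> * \<bar>a\<bar>" by (intro mult_mono) auto
    with assms show False by (simp flip: abs_mult)
  qed
  then show ?thesis by auto
qed

lemma sum_squares_eq_1:
  fixes m :: "'a \<Rightarrow> int"
  assumes "finite A" and sum: "(\<Sum>i\<in>A. m i * m i) = 1"
  obtains i where "i \<in> A" "m i * m i = 1" "\<And>j. j \<in> A \<Longrightarrow> j \<noteq> i \<Longrightarrow> m j = 0"
proof -
  have "\<exists>i\<in>A. m i \<noteq> 0"
  proof (rule ccontr)
    assume "\<not> ?thesis"
    then show False using sum by simp
  qed
  then obtain i where i: "i \<in> A" "m i \<noteq> 0" by blast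
  then have "0 < m i * m i" by (simp add: zero_less_mult_iff) linarith
  then have ge: "1 \<le> m i * m i" by linarith
  have split: "m i * m i + (\<Sum>j\<in>A - {i}. m j * m j) = 1"
    using sum sum.remove[of A i "\<lambda>j. m j * m j"] i assms(1) by simp
  moreover have nonneg: "(\<Sum>j\<in>A - {i}. m j * m j) \<ge> 0" by (simp add: sum_nonneg)
  ultimately have rest: "(\<Sum>j\<in>A - {i}. m j * m j) = 0" using ge by linarith
  then have "\<forall>j\<in>A - {i}. m j * m j = 0"
    using assms(1) by (subst (asm) sum_nonneg_eq_0_iff) auto
  moreover have "m i * m i = 1" using split rest by linarith
  ultimately show thesis using i that by auto
qed

lemma odd_square_bound: "1 \<le> (2 * a + 1) * (2 * a + 1)" for a :: int
proof -
  have "0 \<le> a * (a + 1)" by (cases "a \<ge> 0") (auto simp: zero_le_mult_iff)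
  then show ?thesis by (simp add: algebra_simps)
qed

lemma sum_distinct4:
  fixes F :: "'i::finite \<Rightarrow> 'a::comm_monoid_add"
  assumes "distinct [i, j, k, l]" "UNIV = {i, j, k, l}"
  shows "sum F UNIV = F i + (F j + (F k + F l))"
  unfolding assms(2) using assms(1) by simp

lemma int_lattice_add:
  assumes "x \<in> int_lattice S" "y \<in> int_lattice S"
  shows "x + y \<in> int_lattice S"
proof -
  obtain n m where "x = (\<Sum>\<alpha>\<in>S. of_int (n \<alpha>) *\<^sub>R \<alpha>)" "y = (\<Sum>\<alpha>\<in>S. of_int (m \<alpha>) *\<^sub>R \<alpha>)"
    using assms unfolding int_lattice_def by blast
  then have "x + y = (\<Sum>\<alpha>\<in>S. of_int (n \<alpha> + m \<alpha>) *\<^sub>R \<alpha>)" by (simp add: sum.distrib algebra_simps)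
  then show ?thesis unfolding int_lattice_def by (intro CollectI exI[of _ "\<lambda>\<alpha>. n \<alpha> + m \<alpha>"]) simp
qed

section \<open>The lattice of Hurwitz quaternions\<close>

locale f4_frame =
  fixes B :: "'v::real_vector \<Rightarrow> 'v \<Rightarrow> real" and \<epsilon> :: "4 \<Rightarrow> 'v" and \<delta> :: 'v
  assumes frame: "affine_frame B \<epsilon> \<delta>"
begin

abbreviation short :: "'v set" where "short \<equiv> F4_short \<epsilon>"
abbreviation long :: "'v set" where "long \<equiv> F4_long \<epsilon>"
abbreviation F4 :: "'v set" where "F4 \<equiv> F4_roots \<epsilon>"
abbreviation \<Phi> :: "'v set" where "\<Phi> \<equiv> E62_roots \<epsilon> \<delta>"

lemma bilinear_B: "bilinear B"
  using frame by (simp add: affine_frame_def)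

lemma B_commute: "B x y = B y x"
  using frame by (simp add: affine_frame_def)

lemma B_frame: "B (\<epsilon> i) (\<epsilon> j) = (if i = j then 1 else 0)"
  using frame by (simp add: affine_frame_def)

lemma B_delta [simp]: "B \<delta> x = 0" "B x \<delta> = 0"
  using frame B_commute[of x \<delta>] by (simp_all add: affine_frame_def)

lemmas B_expand =
  bilinear_ladd[OF bilinear_B] bilinear_radd[OF bilinear_B]
  bilinear_lsub[OF bilinear_B] bilinear_rsub[OF bilinear_B]
  bilinear_lneg[OF bilinear_B] bilinear_rneg[OF bilinear_B]
  bilinear_lmul[OF bilinear_B] bilinear_rmul[OF bilinear_B]
  bilinear_lzero[OF bilinear_B] bilinear_rzero[OF bilinear_B]

text \<open>
  Coordinates are doubled so that they are integers; an element of \<open>L\<close> then has coordinates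
  that are all even (a point of the lattice spanned by \<open>\<epsilon>\<close>) or all odd.
\<close>

definition hur :: "(4 \<Rightarrow> int) \<Rightarrow> 'v" where
  "hur n = (1/2) *\<^sub>R (\<Sum>i\<in>UNIV. of_int (n i) *\<^sub>R \<epsilon> i)"

definition hurwitz :: "'v set" where
  "hurwitz = {hur n | n. \<forall>i j. even (n i) = even (n j)}"

lemma hurwitzI: "(\<And>i j. even (n i) = even (n j)) \<Longrightarrow> hur n \<in> hurwitz"
  unfolding hurwitz_def by blast

lemma hurwitzE:
  assumes "x \<in> hurwitz"
  obtains n where "x = hur n" "\<And>i j. even (n i) = even (n j)"
  using assms unfolding hurwitz_def by blast

lemma hurwitz_cases:
  assumes "x \<in> hurwitz"
  obtains (even) m where "x = hur (\<lambda>i. 2 * m i)" | (odd) m where "x = hur (\<lambda>i. 2 * m i + 1)"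
proof -
  obtain n where n: "x = hur n" "\<And>i j. even (n i) = even (n j)"
    using assms by (blast elim: hurwitzE)
  show thesis
  proof (cases "even (n 1)")
    case True
    then have "n = (\<lambda>i. 2 * (n i div 2))" using n(2) by (metis dvd_mult_div_cancel)
    then show thesis using n(1) even by metis
  next
    case False
    then have "n = (\<lambda>i. 2 * (n i div 2) + 1)" using n(2) by (metis odd_two_times_div_two_succ)
    then show thesis using n(1) odd by metis
  qed
qed

lemma hur_add: "hur n + hur m = hur (\<lambda>i. n i + m i)"
  by (simp add: hur_def sum.distrib algebra_simps)

lemma hur_minus: "- hur n = hur (\<lambda>i. - n i)"
  by (simp add: hur_def sum_negf)

lemma B_hur: "B (hur n) (hur m) = of_int (\<Sum>i\<in>UNIV. n i * m i) / 4"
  by (simp add: hur_def sum_4 B_expand B_frame field_simps)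

lemma B_hur_eq: "B (hur n) (hur m) = of_int k \<longleftrightarrow> (\<Sum>i\<in>UNIV. n i * m i) = 4 * k"
proof -
  have "B (hur n) (hur m) = of_int k \<longleftrightarrow> real_of_int (\<Sum>i\<in>UNIV. n i * m i) = of_int (4 * k)"
    unfolding B_hur by (simp only: of_int_mult) (simp add: field_simps)
  then show ?thesis by (simp only: of_int_eq_iff)
qed

lemma B_hur_double_eq:
  "B (hur (\<lambda>i. 2 * m i)) (hur (\<lambda>i. 2 * m i)) = of_int k \<longleftrightarrow> (\<Sum>i\<in>UNIV. m i * m i) = k"
proof -
  have "(\<Sum>i\<in>UNIV. 2 * m i * (2 * m i)) = 4 * (\<Sum>i\<in>UNIV. m i * m i)"
    by (simp add: sum_distrib_left mult.assoc mult.left_commute)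
  then show ?thesis unfolding B_hur_eq by simp
qed

lemma hurwitz_add: "x \<in> hurwitz \<Longrightarrow> y \<in> hurwitz \<Longrightarrow> x + y \<in> hurwitz"
  by (elim hurwitzE) (metis (mono_tags, lifting) hur_add hurwitzI even_add)

lemma hurwitz_minus: "x \<in> hurwitz \<Longrightarrow> - x \<in> hurwitz"
  by (elim hurwitzE) (simp add: hur_minus hurwitzI)

lemma hurwitz_diff: "x \<in> hurwitz \<Longrightarrow> y \<in> hurwitz \<Longrightarrow> x - y \<in> hurwitz"
  using hurwitz_add[OF _ hurwitz_minus] by (metis add_uminus_conv_diff)

lemma hurwitz_zero: "0 \<in> hurwitz"
proof -
  have "hur (\<lambda>i. 0) \<in> hurwitz" by (rule hurwitzI) simp
  then show ?thesis by (simp add: hur_def)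
qed

lemma hurwitz_of_int: "x \<in> hurwitz \<Longrightarrow> of_int k *\<^sub>R x \<in> hurwitz"
proof (induction k rule: int_induct[where k=0])
  case base
  then show ?case by (simp add: hurwitz_zero)
next
  case (step1 i)
  then show ?case by (simp add: algebra_simps hurwitz_add)
next
  case (step2 i)
  then show ?case by (simp add: algebra_simps hurwitz_diff)
qed

lemma hurwitz_span: "x \<in> hurwitz \<Longrightarrow> x \<in> span (range \<epsilon>)"
  by (elim hurwitzE) (simp add: hur_def span_sum span_scale span_base)

text \<open>With doubled coordinates the product is a quarter of \<open>\<Sum> n i * m i\<close>, so that sum has to be even.
  It is if one factor has even coordinates; otherwise it is a sum of four odd numbers.\<close>

lemma B_hurwitz_half_integral:
  assumes "x \<in> hurwitz" "y \<in> hurwitz"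
  shows "2 * B x y \<in> \<int>"
proof -
  have "\<exists>k::int. 2 * B x y = of_int k"
    using assms(1)
  proof (cases rule: hurwitz_cases)
    case (even m)
    from assms(2) obtain n where n: "y = hur n" "\<And>i j. even (n i) = even (n j)"
      by (blast elim: hurwitzE)
    show ?thesis
      by (rule exI[of _ "\<Sum>i\<in>UNIV. m i * n i"]) (simp add: even n B_hur sum_4 field_simps)
  next
    case (odd m)
    note x = this
    from assms(2) show ?thesis
    proof (cases rule: hurwitz_cases)
      case (even n)
      show ?thesis
        by (rule exI[of _ "\<Sum>i\<in>UNIV. (2 * m i + 1) * n i"])
           (simp add: even x B_hur sum_4 field_simps)
    next
      case (odd n)
      show ?thesis
        by (rule exI[of _ "2 + (\<Sum>i\<in>UNIV. 2 * m i * n i + m i + n i)"])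
           (simp add: odd x B_hur sum_4 field_simps)
    qed
  qed
  then show ?thesis by auto
qed

lemma hurwitz_norm_zero: "x \<in> hurwitz \<Longrightarrow> B x x = 0 \<Longrightarrow> x = 0"
proof (elim hurwitzE)
  fix n assume x: "x = hur n" and "B x x = 0"
  then have "(\<Sum>i\<in>UNIV. n i * n i) = 0" using B_hur_eq[of n n 0] by simp
  then have "n i = 0" for i
    by (simp add: sum_nonneg_eq_0_iff)
  then show "x = 0" by (simp add: x hur_def)
qed

lemma B_hurwitz_nonneg: "x \<in> hurwitz \<Longrightarrow> 0 \<le> B x x"
  by (elim hurwitzE) (simp add: B_hur sum_nonneg)

lemma short_subset: "x \<in> short \<Longrightarrow> x \<in> hurwitz \<and> B x x = 1"
proof -
  assume "x \<in> short"
  then consider (unit) s i where "x = s *\<^sub>R \<epsilon> i" "s \<in> {1, -1}"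
    | (half) l where "x = (1/2) *\<^sub>R (\<Sum>i\<in>UNIV. l i *\<^sub>R \<epsilon> i)" "\<forall>i. l i \<in> {1, -1}"
    unfolding F4_short_def by blast
  then show ?thesis
  proof cases
    case unit
    define n where "n = (\<lambda>k. if k = i then 2 * \<lfloor>s\<rfloor> else 0)"
    have "x = hur n"
      using unit by (auto simp: hur_def n_def if_distrib[of "\<lambda>c. of_int c"]
          if_distrib[of "\<lambda>c. c *\<^sub>R _"] cong: if_cong)
    moreover have "hur n \<in> hurwitz" by (rule hurwitzI) (simp add: n_def)
    moreover have "B x x = 1" using unit by (auto simp: B_expand B_frame)
    ultimately show ?thesis by simp
  next
    case half
    define n where "n = (\<lambda>k. \<lfloor>l k\<rfloor>)"
    have lk: "l k = 1 \<or> l k = -1" for k using half(2) by blast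
    have l: "l k = of_int (n k)" and n: "n k = 1 \<or> n k = -1" for k
      using lk[of k] unfolding n_def by (metis floor_one floor_uminus_of_int of_int_1 of_int_minus)+
    have "x = hur n" using half(1) by (simp add: hur_def l)
    moreover have "hur n \<in> hurwitz"
      by (rule hurwitzI) (metis n odd_one even_minus)
    moreover have "n k * n k = 1" for k using n[of k] by auto
    ultimately show ?thesis by (simp add: B_hur)
  qed
qed

lemma frame_pair_hur:
  assumes "i \<noteq> j"
  shows "of_int s *\<^sub>R \<epsilon> i + of_int t *\<^sub>R \<epsilon> j
         = hur (\<lambda>k. 2 * ((if k = i then s else 0) + (if k = j then t else 0)))"
  by (simp add: hur_def scaleR_right.sum sum.distrib algebra_simps if_distrib[of "\<lambda>c. c *\<^sub>R _"]
          if_distrib[of "\<lambda>c. of_int c"] cong: if_cong)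

lemma long_subset: "x \<in> long \<Longrightarrow> x \<in> hurwitz \<and> B x x = 2"
proof -
  assume "x \<in> long"
  then obtain s t i j where x: "x = s *\<^sub>R \<epsilon> i + t *\<^sub>R \<epsilon> j" "s \<in> {1, -1}" "t \<in> {1, -1}" "i \<noteq> j"
    unfolding F4_long_def by blast
  have "x = of_int \<lfloor>s\<rfloor> *\<^sub>R \<epsilon> i + of_int \<lfloor>t\<rfloor> *\<^sub>R \<epsilon> j" using x by auto
  then have "x \<in> hurwitz"
    unfolding frame_pair_hur[OF x(4)] by (simp add: hurwitzI)
  then show ?thesis using x by (auto simp: B_expand B_frame)
qed

text \<open>Four squares with sum 4 and equal parities: all are 1, or one is 4 and the others vanish.\<close>

lemma short_if: "x \<in> hurwitz \<Longrightarrow> B x x = 1 \<Longrightarrow> x \<in> short"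
proof (erule hurwitz_cases)
  fix m assume x: "x = hur (\<lambda>i. 2 * m i)" and "B x x = 1"
  then have sum: "(\<Sum>i\<in>UNIV. m i * m i) = 1"
    using B_hur_double_eq[of m 1] by simp
  then obtain i where i: "m i * m i = 1" "\<And>j. j \<noteq> i \<Longrightarrow> m j = 0"
    using sum_squares_eq_1[of UNIV m] by auto
  have "x = (\<Sum>j\<in>UNIV. (if j = i then of_int (m i) *\<^sub>R \<epsilon> i else 0))"
    unfolding x hur_def scaleR_right.sum by (rule sum.cong) (auto simp: i(2))
  then have "x = of_int (m i) *\<^sub>R \<epsilon> i" by simp
  moreover have "m i = 1 \<or> m i = -1"  using int_square_cases[of "m i"] i(1) by auto
  ultimately show ?thesis unfolding F4_short_def
    by (intro UnI1 CollectI exI[of _ "real_of_int (m i)"] exI[of _ i]) auto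
next
  fix m assume x: "x = hur (\<lambda>i. 2 * m i + 1)" and B: "B x x = 1"
  define n where "n = (\<lambda>i. 2 * m i + 1)"
  have "(\<Sum>i\<in>UNIV. n i * n i) = 4"
    using B B_hur_eq[of n n 1] unfolding x n_def[symmetric] by simp
  moreover have "1 \<le> n i * n i" for i unfolding n_def by (rule odd_square_bound)
  moreover note this[of 1] this[of 2] this[of 3] this[of 4]
  ultimately have "\<forall>i. n i * n i = 1"
    unfolding sum_4 forall_4 by linarith
  then have "n i = 1 \<or> n i = -1" for i
    using int_square_cases[of "n i"] by (metis mult_zero_left zero_neq_one one_le_numeral)
  then have "\<forall>i. real_of_int (n i) \<in> {1, -1}"
    by (metis insertI1 insertI2 of_int_1 of_int_minus)
  then show ?thesis unfolding F4_short_def x n_def[symmetric] hur_def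
    by (intro UnI2 CollectI exI[of _ "\<lambda>i. of_int (n i)"]) auto
qed

lemma long_if: "x \<in> hurwitz \<Longrightarrow> B x x = 2 \<Longrightarrow> x \<in> long"
proof (erule hurwitz_cases)
  fix m assume x: "x = hur (\<lambda>i. 2 * m i)" and "B x x = 2"
  then have sum: "(\<Sum>i\<in>UNIV. m i * m i) = 2"
    using B_hur_double_eq[of m 2] by simp
  have "\<exists>i. m i \<noteq> 0"
  proof (rule ccontr)
    assume "\<not> ?thesis"
    then show False using sum by simp
  qed
  then obtain i where i: "m i \<noteq> 0" by blast
  have split: "m i * m i + (\<Sum>j\<in>UNIV - {i}. m j * m j) = 2"
    using sum sum.remove[of UNIV i "\<lambda>j. m j * m j"] by simp
  moreover have "(\<Sum>j\<in>UNIV - {i}. m j * m j) \<ge> 0" by (simp add: sum_nonneg)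
  ultimately have mi: "m i = 1 \<or> m i = -1" using int_square_cases[of "m i"] i by linarith
  with split have "(\<Sum>j\<in>UNIV - {i}. m j * m j) = 1" by auto
  then obtain j where j: "j \<noteq> i" "m j * m j = 1" "\<And>k. k \<noteq> i \<Longrightarrow> k \<noteq> j \<Longrightarrow> m k = 0"
    using sum_squares_eq_1[of "UNIV - {i}" m] by auto
  have mj: "m j = 1 \<or> m j = -1" using int_square_cases[of "m j"] j(2) by auto
  have ij: "i \<noteq> j" "\<And>k. k \<noteq> i \<Longrightarrow> k \<noteq> j \<Longrightarrow> m k = 0" using j by auto
  then have "(\<lambda>k. 2 * m k) = (\<lambda>k. 2 * ((if k = i then m i else 0) + (if k = j then m j else 0)))"
    by (intro ext) auto
  then have "x = of_int (m i) *\<^sub>R \<epsilon> i + of_int (m j) *\<^sub>R \<epsilon> j"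
    unfolding x frame_pair_hur[OF ij(1)] by simp
  moreover have "real_of_int (m i) \<in> {1, -1}" "real_of_int (m j) \<in> {1, -1}"
    using mi mj by auto
  ultimately show ?thesis unfolding F4_long_def
    by (intro CollectI exI[of _ "real_of_int (m i)"] exI[of _ "real_of_int (m j)"]
          exI[of _ i] exI[of _ j] conjI ij(1))
next
  fix m assume x: "x = hur (\<lambda>i. 2 * m i + 1)" and B: "B x x = 2"
  have "(\<Sum>i\<in>UNIV. (2 * m i + 1) * (2 * m i + 1)) = 8"
    using B B_hur_eq[of "\<lambda>i. 2 * m i + 1" "\<lambda>i. 2 * m i + 1" 2] unfolding x by simp
  \<comment> \<open>An odd square is 1 modulo 8, so four of them add up to 4 modulo 8.\<close>
  moreover have "\<exists>q. (2 * m i + 1) * (2 * m i + 1) = 8 * q + 1" for i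
  proof -
    have "even (m i * (m i + 1))" by simp
    then obtain q where "m i * (m i + 1) = 2 * q" by blast
    then have "(2 * m i + 1) * (2 * m i + 1) = 8 * q + 1" by (simp add: algebra_simps)
    then show ?thesis by blast
  qed
  then obtain q where "\<And>i. (2 * m i + 1) * (2 * m i + 1) = 8 * q i + 1" by metis
  ultimately have "8 * (q 1 + q 2 + q 3 + q 4) + 4 = 8" by (simp add: sum_4)
  then have False by presburger
  then show ?thesis ..
qed

lemma short_iff: "x \<in> short \<longleftrightarrow> x \<in> hurwitz \<and> B x x = 1"
  using short_subset short_if by blast

lemma long_iff: "x \<in> long \<longleftrightarrow> x \<in> hurwitz \<and> B x x = 2"
  using long_subset long_if by blast

lemma short_minus: "x \<in> short \<Longrightarrow> - x \<in> short"
  by (simp add: short_iff hurwitz_minus B_expand)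

lemma short_hurwitz: "x \<in> short \<Longrightarrow> x \<in> hurwitz"
  by (simp add: short_iff)

lemma long_hurwitz: "x \<in> long \<Longrightarrow> x \<in> hurwitz"
  by (simp add: long_iff)

lemma F4_iff: "x \<in> F4 \<longleftrightarrow> x \<in> short \<or> x \<in> long"
  by (simp add: F4_roots_def)

lemma F4_hurwitz: "x \<in> F4 \<Longrightarrow> x \<in> hurwitz"
  by (auto simp: F4_iff short_hurwitz long_hurwitz)

lemma short_not_long: "x \<in> short \<Longrightarrow> x \<notin> long"
  by (simp add: short_iff long_iff)

lemma B_long_hurwitz_integral:
  assumes "x \<in> long" "y \<in> hurwitz"
  shows "B x y \<in> \<int>" "B y x \<in> \<int>"
proof -
  obtain s t i j where x: "x = s *\<^sub>R \<epsilon> i + t *\<^sub>R \<epsilon> j" "s \<in> {1, -1}" "t \<in> {1, -1}" "i \<noteq> j"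
    using assms(1) unfolding F4_long_def by blast
  obtain n where y: "y = hur n" "\<And>i j. even (n i) = even (n j)"
    using assms(2) by (blast elim: hurwitzE)
  have coord: "B (\<epsilon> k) y = of_int (n k) / 2" for k
    by (simp add: y(1) hur_def linear_sum[OF bilinear_B[unfolded bilinear_def, THEN conjunct1, rule_format]]
        B_expand B_frame if_distrib[of "\<lambda>c. _ * c"] cong: if_cong)
  have "even (n i + n j)" "even (n i - n j)" "even (- n i + n j)" "even (- n i - n j)"
    using y(2)[of i j] by auto
  then obtain a b c d where "n i + n j = 2 * a" "n i - n j = 2 * b" "- n i + n j = 2 * c" "- n i - n j = 2 * d"
    unfolding dvd_def by blast
  then have "real_of_int (n i) + n j = 2 * of_int a" "real_of_int (n i) - n j = 2 * of_int b"
    "- real_of_int (n i) + n j = 2 * of_int c" "- real_of_int (n i) - n j = 2 * of_int d"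
    by linarith+
  then have "B x y = of_int a \<or> B x y = of_int b \<or> B x y = of_int c \<or> B x y = of_int d"
    using x(2,3) by (auto simp: x(1) B_expand coord field_simps)
  then show "B x y \<in> \<int>" by auto
  then show "B y x \<in> \<int>" by (simp add: B_commute)
qed

lemma long_split:
  assumes "x \<in> long"
  obtains a b where "a \<in> short" "b \<in> short" "B a b = 0" "x = a + b"
proof -
  obtain s t i j where x: "x = s *\<^sub>R \<epsilon> i + t *\<^sub>R \<epsilon> j" "s \<in> {1, -1}" "t \<in> {1, -1}" "i \<noteq> j"
    using assms(1) unfolding F4_long_def by blast
  have "s *\<^sub>R \<epsilon> i \<in> short" "t *\<^sub>R \<epsilon> j \<in> short" unfolding F4_short_def using x by blast+
  then show thesis using that x by (simp add: B_expand B_frame)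
qed

lemma frame_short: "\<epsilon> i \<in> short"
proof -
  have "1 *\<^sub>R \<epsilon> i \<in> short" unfolding F4_short_def by blast
  then show ?thesis by simp
qed

lemma half_short: "(\<And>i. l i \<in> {1, -1}) \<Longrightarrow> (1/2) *\<^sub>R (\<Sum>i\<in>UNIV. l i *\<^sub>R \<epsilon> i) \<in> short"
  unfolding F4_short_def by blast

text \<open>Two short roots have product \<open>0\<close>, \<open>\<plusminus>1/2\<close> or \<open>\<plusminus>1\<close>, so a non-integral product means that they
  span a root system of type \<open>A\<^sub>2\<close>. This is the adjacency relation used below.\<close>

lemma short_neighbour:
  assumes "x \<in> short"
  obtains z where "z \<in> short" "B x z \<notin> \<int>"
proof -
  from assms consider (unit) s i where "x = s *\<^sub>R \<epsilon> i" "s \<in> {1, -1}"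
    | (half) l where "x = (1/2) *\<^sub>R (\<Sum>i\<in>UNIV. l i *\<^sub>R \<epsilon> i)" "\<forall>i. l i \<in> {1, -1}"
    unfolding F4_short_def by blast
  then show thesis
  proof cases
    case unit
    let ?h = "(1/2) *\<^sub>R (\<Sum>j\<in>UNIV. 1 *\<^sub>R \<epsilon> j)"
    have "?h \<in> short" by (rule half_short) simp
    moreover have "B (\<epsilon> i) ?h = 1/2"
      using exhaust_4[of i] by (auto simp: B_expand B_frame sum_4)
    then have "B x ?h \<notin> \<int>" using half_not_Ints unit by (auto simp: B_expand)
    ultimately show thesis by (rule that)
  next
    case half
    have "B x (\<epsilon> 1) = l 1 / 2" by (simp add: half B_expand B_frame sum_4)
    then show thesis using that[OF frame_short] half(2) half_not_Ints
      by (metis insertE singletonD)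
  qed
qed

section \<open>Products of roots\<close>

lemma B_Cauchy:
  assumes "x \<in> hurwitz" "y \<in> hurwitz"
  shows "2 * \<bar>B x y\<bar> \<le> B x x + B y y"
  using B_hurwitz_nonneg[OF hurwitz_add[OF assms]] B_hurwitz_nonneg[OF hurwitz_diff[OF assms]]
  by (simp add: B_expand B_commute[of y x])

lemma B_short_short:
  assumes "x \<in> short" "y \<in> short"
  shows "B x y = -1 \<or> B x y = -1/2 \<or> B x y = 0 \<or> B x y = 1/2 \<or> B x y = 1"
proof -
  have "2 * B x y = -2 \<or> 2 * B x y = -1 \<or> 2 * B x y = 0 \<or> 2 * B x y = 1 \<or> 2 * B x y = 2"
    using B_Cauchy[of x y] assms
    by (intro Ints_bounded B_hurwitz_half_integral) (auto simp: short_iff)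
  then show ?thesis by linarith
qed

lemma B_long_short:
  assumes "x \<in> long" "y \<in> short"
  shows "B x y = -1 \<or> B x y = 0 \<or> B x y = 1"
proof -
  have "2 * \<bar>B x y\<bar> \<le> 3" using B_Cauchy[of x y] assms by (simp add: short_iff long_iff)
  moreover from this have "B x y = -2 \<or> B x y = -1 \<or> B x y = 0 \<or> B x y = 1 \<or> B x y = 2"
    using assms by (intro Ints_bounded B_long_hurwitz_integral) (auto simp: short_hurwitz)
  ultimately show ?thesis by auto
qed

lemma B_long_long:
  assumes "x \<in> long" "y \<in> long"
  shows "B x y = -2 \<or> B x y = -1 \<or> B x y = 0 \<or> B x y = 1 \<or> B x y = 2"
  using B_Cauchy[of x y] assms
  by (intro Ints_bounded B_long_hurwitz_integral) (auto simp: long_iff)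

lemma B_short_short_odd:
  assumes "x \<in> short" "y \<in> short" "B x y \<notin> \<int>"
  shows "B x y = 1/2 \<or> B x y = -1/2"
  using B_short_short[OF assms(1,2)] assms(3) by auto

lemma hurwitz_norm_eq:
  assumes "x \<in> hurwitz" "y \<in> hurwitz" "B x x - 2 * B x y + B y y = 0"
  shows "x = y"
  using hurwitz_norm_zero[OF hurwitz_diff[OF assms(1,2)]] assms(3)
  by (simp add: B_expand B_commute[of y x])

lemma short_eqI:
  assumes "x \<in> hurwitz" "y \<in> hurwitz" "B x x = B y y" "B x y = B y y"
  shows "x = y"
  using hurwitz_norm_eq[OF assms(1,2)] assms(3,4) by simp

lemma short_add:
  assumes "x \<in> short" "y \<in> short"
  shows "x + y \<in> short \<longleftrightarrow> B x y = -1/2" "x + y \<in> long \<longleftrightarrow> B x y = 0"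
  using assms by (auto simp: short_iff long_iff hurwitz_add B_expand B_commute[of y x])

lemma short_diff:
  assumes "x \<in> short" "y \<in> short"
  shows "x - y \<in> short \<longleftrightarrow> B x y = 1/2" "x - y \<in> long \<longleftrightarrow> B x y = 0"
  using assms by (auto simp: short_iff long_iff hurwitz_diff B_expand B_commute[of y x])

lemma long_short_add:
  assumes "x \<in> long" "y \<in> short"
  shows "x + y \<in> short \<longleftrightarrow> B x y = -1" "x + y \<notin> long"
proof -
  show "x + y \<in> short \<longleftrightarrow> B x y = -1"
    using assms by (auto simp: short_iff long_iff hurwitz_add B_expand B_commute[of y x])
  show "x + y \<notin> long"
    using assms B_long_short[OF assms] by (auto simp: short_iff long_iff B_expand B_commute[of y x])
qed

text \<open>The sum of \<open>a\<close> and \<open>b\<close> is a long root, and long roots have integral products with all of \<open>L\<close>.\<close>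

lemma orthogonal_short_parity:
  assumes "a \<in> short" "b \<in> short" "B a b = 0" "c \<in> short"
  shows "B c a \<in> \<int> \<longleftrightarrow> B c b \<in> \<int>"
proof -
  have "B c (a + b) \<in> \<int>"
    using assms B_long_hurwitz_integral(2)[of "a + b" c] by (simp add: short_add short_hurwitz)
  then have sum: "B c a + B c b \<in> \<int>" by (simp add: B_expand)
  have "B c a = (B c a + B c b) - B c b" "B c b = (B c a + B c b) - B c a" by simp_all
  then show ?thesis using sum Ints_diff by metis
qed

text \<open>A property that survives adding short roots spreads from one short root to all of them:
  it passes between adjacent roots, and any two roots are adjacent or have a common
  neighbour, because a neighbour of \<open>x\<close> is adjacent to \<open>- x\<close> and to every root orthogonal to \<open>x\<close>.\<close>

lemma short_connected:
  assumes "x \<in> short" "y \<in> short" "Q x"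
    and step: "\<And>u v. u \<in> short \<Longrightarrow> v \<in> short \<Longrightarrow> u + v \<in> short \<Longrightarrow> Q u \<Longrightarrow> Q (u + v)"
  shows "Q y"
proof -
  have adjacent: "Q v" if uv: "u \<in> short" "v \<in> short" "B u v \<notin> \<int>" "Q u" for u v
  proof -
    have acute: "Q v" if "u \<in> short" "v \<in> short" "B u v = 1/2" "Q u" for u v
    proof -
      have "v - u \<in> short" using that by (simp add: short_diff B_commute)
      then show ?thesis using step[of u "v - u"] that by simp
    qed
    consider "B u v = 1/2" | "B u v = -1/2" using B_short_short_odd uv by blast
    then show ?thesis
    proof cases
      case 1
      then show ?thesis using acute uv by blast
    next
      case 2
      then have s: "u + v \<in> short" using uv by (simp add: short_add)
      then have "Q (u + v)" using step uv by blast
      moreover have "B (u + v) v = 1/2" using 2 uv by (simp add: B_expand short_iff)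
      ultimately show ?thesis using acute s uv by blast
    qed
  qed
  show ?thesis
  proof (cases "B x y \<in> \<int>")
    case False
    then show ?thesis using adjacent assms by blast
  next
    case True
    obtain z where z: "z \<in> short" "B x z \<notin> \<int>" using short_neighbour assms by blast
    have "B x y \<noteq> 1/2" "B x y \<noteq> -1/2" using True half_not_Ints by metis+
    then consider "B x y = 0" | "B x y = 1" | "B x y = -1"
      using B_short_short[OF assms(1,2)] by blast
    then consider "B x y = 0" | "x = y" | "x = - y"
      using short_eqI[of x y] short_eqI[of x "- y"] assms
      by cases (simp_all add: short_iff B_expand hurwitz_minus)
    then have "B z y \<notin> \<int>"
    proof cases
      case 1
      then show ?thesis using orthogonal_short_parity[of x y z] assms z by (simp add: B_commute)
    qed (use z in \<open>auto simp: B_commute B_expand\<close>)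
    then show ?thesis using adjacent z assms by blast
  qed
qed

section \<open>Affine roots and parity conditions\<close>

definition aff :: "'v \<Rightarrow> int \<Rightarrow> 'v" where
  "aff x r = x + of_int r *\<^sub>R \<delta>"

lemma aff_add: "aff x r + aff y s = aff (x + y) (r + s)"
  by (simp add: aff_def algebra_simps)

lemma aff_minus: "- aff x r = aff (- x) (- r)"
  by (simp add: aff_def)

lemma B_aff [simp]: "B (aff x r) y = B x y" "B y (aff x r) = B y x"
  by (simp_all add: aff_def B_expand)

lemma span_delta_eq:
  assumes "x \<in> span (range \<epsilon>)" "y \<in> span (range \<epsilon>)" "x + a *\<^sub>R \<delta> = y + b *\<^sub>R \<delta>"
  shows "x = y \<and> a = b"
proof -
  have "(a - b) *\<^sub>R \<delta> = y - x" using assms(3) by (simp add: algebra_simps)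
  then have *: "(a - b) *\<^sub>R \<delta> \<in> span (range \<epsilon>)" using assms by (simp add: span_diff)
  have "a = b"
  proof (rule ccontr)
    assume "a \<noteq> b"
    then have "\<delta> \<in> span (range \<epsilon>)" using span_scale[OF *, of "inverse (a - b)"] by simp
    then show False using frame by (simp add: affine_frame_def)
  qed
  then show ?thesis using assms(3) by simp
qed

lemma aff_eq_iff:
  assumes "x \<in> hurwitz" "y \<in> hurwitz"
  shows "aff x r = aff y s \<longleftrightarrow> x = y \<and> r = s"
  using span_delta_eq[of x y "of_int r" "of_int s"] assms hurwitz_span
  by (auto simp: aff_def)

lemma E62_E:
  assumes "\<xi> \<in> \<Phi>"
  obtains x r where "\<xi> = aff x r" "x \<in> F4" "x \<in> long \<Longrightarrow> even r"
proof -
  from assms consider (short) x r where "\<xi> = aff x r" "x \<in> short"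
    | (long) x r where "\<xi> = aff x (2 * r)" "x \<in> long"
    unfolding E62_roots_def aff_def by blast
  then show thesis
  proof cases
    case short then show thesis using that short_not_long by (auto simp: F4_iff)
  next
    case long then show thesis using that[of x "2 * r"] by (auto simp: F4_iff)
  qed
qed

lemma aff_E62_iff:
  assumes "x \<in> hurwitz"
  shows "aff x r \<in> \<Phi> \<longleftrightarrow> x \<in> short \<or> x \<in> long \<and> even r"
proof
  assume "aff x r \<in> \<Phi>"
  then obtain y s where y: "aff x r = aff y s" "y \<in> F4" "y \<in> long \<Longrightarrow> even s" by (blast elim: E62_E)
  then have "x = y" "r = s" using assms F4_hurwitz by (auto simp: aff_eq_iff)
  then show "x \<in> short \<or> x \<in> long \<and> even r" using y by (auto simp: F4_iff)
next
  assume "x \<in> short \<or> x \<in> long \<and> even r"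
  then show "aff x r \<in> \<Phi>" unfolding E62_roots_def aff_def by (blast elim: evenE)
qed

text \<open>The extra parity statement is what keeps the shift of a long root even under reflections in
  short affine roots.\<close>

lemma cartan_integral:
  assumes "x \<in> F4" "y \<in> F4"
  obtains n :: int where "cartan_int B y x = of_int n" "x \<in> short \<Longrightarrow> y \<in> long \<Longrightarrow> even n"
proof (cases "x \<in> long")
  case True
  then have "cartan_int B y x \<in> \<int>"
    using B_long_hurwitz_integral(2)[of x y] assms F4_hurwitz by (simp add: cartan_int_def long_iff)
  then show thesis using that True short_not_long by (auto elim: Ints_cases)
next
  case False
  then have x: "x \<in> short" using assms by (simp add: F4_iff)
  then have c: "cartan_int B y x = 2 * B y x" by (simp add: cartan_int_def short_iff)
  show thesis
  proof (cases "y \<in> long")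
    case True
    then obtain k where "B y x = of_int k"
      using B_long_hurwitz_integral(1)[of y x] x by (auto simp: short_hurwitz elim: Ints_cases)
    then show thesis using that[of "2 * k"] c by simp
  next
    case False
    then show thesis using that c B_hurwitz_half_integral[of y x] assms F4_hurwitz
      by (auto elim: Ints_cases)
  qed
qed

lemma refl_length:
  assumes "x \<in> F4" "y \<in> F4"
  shows "y \<in> short \<Longrightarrow> refl_root B x y \<in> short" "y \<in> long \<Longrightarrow> refl_root B x y \<in> long"
proof -
  obtain n :: int where n: "cartan_int B y x = of_int n" using cartan_integral assms by blast
  have "B x x \<noteq> 0" using assms by (auto simp: F4_iff short_iff long_iff)
  then have "B (refl_root B x y) (refl_root B x y) = B y y"
    by (simp add: refl_root_def cartan_int_def B_expand B_commute[of x y] field_simps)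
  moreover have "refl_root B x y \<in> hurwitz"
    unfolding refl_root_def n by (intro hurwitz_diff hurwitz_of_int F4_hurwitz assms)
  ultimately show "y \<in> short \<Longrightarrow> refl_root B x y \<in> short" "y \<in> long \<Longrightarrow> refl_root B x y \<in> long"
    by (simp_all add: short_iff long_iff)
qed

lemma refl_aff:
  assumes "cartan_int B y x = of_int n"
  shows "refl_root B (aff x r) (aff y s) = aff (refl_root B x y) (s - n * r)"
proof -
  have "cartan_int B (aff y s) (aff x r) = of_int n"
    using assms by (simp add: cartan_int_def)
  then show ?thesis using assms by (simp add: refl_root_def aff_def algebra_simps)
qed

text \<open>The set of roots on which a linear form with values in \<open>\<int>/2\<int>\<close> vanishes.\<close>

definition parity_roots :: "'v \<Rightarrow> int \<Rightarrow> 'v set" where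
  "parity_roots w c = {\<xi> \<in> \<Phi>. \<exists>x r. \<xi> = aff x r \<and> x \<in> F4 \<and> (B x w + of_int (c * r)) / 2 \<in> \<int>}"

lemma aff_parity_roots_iff:
  assumes "x \<in> hurwitz"
  shows "aff x r \<in> parity_roots w c \<longleftrightarrow> aff x r \<in> \<Phi> \<and> (B x w + of_int (c * r)) / 2 \<in> \<int>"
proof
  assume "aff x r \<in> parity_roots w c"
  then show "aff x r \<in> \<Phi> \<and> (B x w + of_int (c * r)) / 2 \<in> \<int>"
    using assms unfolding parity_roots_def by (auto simp: aff_eq_iff F4_hurwitz)
next
  assume *: "aff x r \<in> \<Phi> \<and> (B x w + of_int (c * r)) / 2 \<in> \<int>"
  then have "x \<in> F4" using assms by (auto simp: aff_E62_iff F4_iff)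
  then show "aff x r \<in> parity_roots w c" using * unfolding parity_roots_def by blast
qed

text \<open>A reflection changes a root by an integral multiple of the other root, so it preserves the
  parity condition just as sums do.\<close>

lemma parity_roots_closed:
  assumes "parity_roots w c \<noteq> {}"
  shows "closed_subroot_system B \<Phi> (parity_roots w c)"
  unfolding closed_subroot_system_def subroot_system_def root_closed_def
proof (intro conjI ballI impI)
  show "parity_roots w c \<noteq> {}" by fact
  show "parity_roots w c \<subseteq> \<Phi>" by (auto simp: parity_roots_def)
next
  fix \<alpha> \<beta> assume a: "\<alpha> \<in> parity_roots w c" and b: "\<beta> \<in> parity_roots w c"
  obtain x r where x: "\<alpha> = aff x r" "x \<in> F4" "x \<in> long \<Longrightarrow> even r" 
    using a unfolding parity_roots_def by (blast elim: E62_E)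
  obtain y s where y: "\<beta> = aff y s" "y \<in> F4" "y \<in> long \<Longrightarrow> even s"
    using b unfolding parity_roots_def by (blast elim: E62_E)
  note hur = F4_hurwitz[OF x(2)] F4_hurwitz[OF y(2)]
  have px: "(B x w + of_int (c * r)) / 2 \<in> \<int>" and py: "(B y w + of_int (c * s)) / 2 \<in> \<int>"
    using a b hur by (simp_all add: x y aff_parity_roots_iff)
  obtain n where n: "cartan_int B y x = of_int n" "x \<in> short \<Longrightarrow> y \<in> long \<Longrightarrow> even n"
    using cartan_integral x y by blast
  have refl: "refl_root B x y = y - of_int n *\<^sub>R x" by (simp add: refl_root_def n)
  have h: "refl_root B x y \<in> hurwitz"
    unfolding refl by (intro hurwitz_diff hurwitz_of_int hur)
  have "aff (refl_root B x y) (s - n * r) \<in> \<Phi>"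
    using refl_length[OF x(2) y(2)] x(2,3) y(2,3) n(2) by (auto simp: aff_E62_iff[OF h] F4_iff)
  moreover have "(B (refl_root B x y) w + of_int (c * (s - n * r))) / 2
      = (B y w + of_int (c * s)) / 2 - of_int n * ((B x w + of_int (c * r)) / 2)"
    by (simp add: refl B_expand field_simps)
  ultimately show "refl_root B \<alpha> \<beta> \<in> parity_roots w c"
    unfolding x(1) y(1) refl_aff[OF n(1)] aff_parity_roots_iff[OF h]
    using px py by (metis Ints_diff Ints_mult Ints_of_int)
  assume "\<alpha> + \<beta> \<in> \<Phi>"
  moreover have "(B (x + y) w + of_int (c * (r + s))) / 2
      = (B x w + of_int (c * r)) / 2 + (B y w + of_int (c * s)) / 2"
    by (simp add: B_expand field_simps)
  ultimately show "\<alpha> + \<beta> \<in> parity_roots w c"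
    unfolding x(1) y(1) aff_add aff_parity_roots_iff[OF hurwitz_add[OF hur]]
    using px py by (metis Ints_add)
qed

lemma closed_add:
  assumes "closed_subroot_system B \<Phi> \<Psi>" "aff x r \<in> \<Psi>" "aff y s \<in> \<Psi>" "aff (x + y) (r + s) \<in> \<Phi>"
  shows "aff (x + y) (r + s) \<in> \<Psi>"
  using assms unfolding closed_subroot_system_def root_closed_def by (metis aff_add)

lemma closed_minus:
  assumes "closed_subroot_system B \<Phi> \<Psi>" "aff x r \<in> \<Psi>"
  shows "aff (- x) (- r) \<in> \<Psi>"
proof -
  have "aff x r \<in> \<Phi>"
    using assms unfolding closed_subroot_system_def subroot_system_def by blast
  then obtain y s where y: "aff x r = aff y s" "y \<in> F4" by (blast elim: E62_E)
  then have "B y y \<noteq> 0" by (auto simp: F4_iff short_iff long_iff)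
  then have "cartan_int B (aff x r) (aff x r) = 2"
    unfolding y(1) cartan_int_def by simp
  then have "refl_root B (aff x r) (aff x r) = - aff x r"
    by (simp add: refl_root_def scaleR_2)
  moreover have "refl_root B (aff x r) (aff x r) \<in> \<Psi>"
    using assms unfolding closed_subroot_system_def subroot_system_def by blast
  ultimately show ?thesis by (simp add: aff_minus)
qed

lemma gradient_iff: "x \<in> gradient \<epsilon> \<delta> \<Psi> \<longleftrightarrow> x \<in> F4 \<and> (\<exists>r. aff x r \<in> \<Psi>)"
  by (simp add: gradient_def aff_def)

lemma gradient_subroot_system:
  assumes "subroot_system B \<Phi> \<Psi>"
  shows "subroot_system B F4 (gradient \<epsilon> \<delta> \<Psi>)"
  unfolding subroot_system_def
proof (intro conjI ballI)
  obtain \<xi> where "\<xi> \<in> \<Psi>" "\<xi> \<in> \<Phi>" using assms unfolding subroot_system_def by blast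
  then show "gradient \<epsilon> \<delta> \<Psi> \<noteq> {}" by (metis E62_E gradient_iff empty_iff)
  show "gradient \<epsilon> \<delta> \<Psi> \<subseteq> F4" by (auto simp: gradient_iff)
next
  fix x y assume "x \<in> gradient \<epsilon> \<delta> \<Psi>" "y \<in> gradient \<epsilon> \<delta> \<Psi>"
  then obtain r s where *: "x \<in> F4" "y \<in> F4" "aff x r \<in> \<Psi>" "aff y s \<in> \<Psi>"
    by (auto simp: gradient_iff)
  obtain n where n: "cartan_int B y x = of_int n" using cartan_integral * by blast
  have "refl_root B (aff x r) (aff y s) \<in> \<Psi>"
    using assms * unfolding subroot_system_def by blast
  then show "refl_root B x y \<in> gradient \<epsilon> \<delta> \<Psi>"
    using refl_length[OF *(1,2)] *(2) by (auto simp: refl_aff[OF n] gradient_iff F4_iff)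
qed

section \<open>Semi-closed systems that lack a short root\<close>

lemma refl_root_self:
  assumes "x \<in> F4"
  shows "refl_root B x x = - x"
proof -
  have "B x x \<noteq> 0" using assms by (auto simp: F4_iff short_iff long_iff)
  then show ?thesis by (simp add: refl_root_def cartan_int_def scaleR_2)
qed

text \<open>Since \<open>G\<close> is not closed, it contains two orthogonal short roots. If all its short roots
  have integral product with one of them, twice that root serves as \<open>w\<close>. Otherwise the short roots in
  \<open>G\<close> contain a system of type \<open>A\<^sub>3\<close>, and as they are not all of \<open>D\<^sub>4\<close> they are no more than that;
  a long root orthogonal to it serves as \<open>w\<close>.

  In the second case it helps to write \<open>D\<^sub>4\<close> as \<open>\<plusminus>x\<^sub>a \<plusminus> x\<^sub>b\<close> with orthogonal vectors \<open>x\<^sub>1, \<dots>, x\<^sub>4\<close>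
  of norm \<open>1/2\<close> such that \<open>\<alpha> = x\<^sub>1 + x\<^sub>2\<close>, \<open>\<beta> = x\<^sub>1 - x\<^sub>2\<close>, \<open>\<gamma> = x\<^sub>1 + x\<^sub>3\<close> and \<open>\<eta> = x\<^sub>1 + x\<^sub>4\<close> is a
  missing root. Then \<open>\<mu> = 2 x\<^sub>4 = 2\<eta> - \<alpha> - \<beta>\<close> is orthogonal to \<open>\<alpha>\<close>, \<open>\<beta>\<close>, \<open>\<gamma>\<close>. A short root of
  \<open>G\<close> with product 1 with \<open>\<mu>\<close> is \<open>x\<^sub>4 + y\<close> with \<open>y\<close> one of \<open>\<plusminus>x\<^sub>1, \<plusminus>x\<^sub>2, \<plusminus>x\<^sub>3\<close>, and \<open>\<eta>\<close> is obtained
  from it by adding roots of the \<open>A\<^sub>3\<close>, which would put \<open>\<eta>\<close> into \<open>G\<close>. A long root of \<open>G\<close> with odd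
  product with \<open>\<mu>\<close> is either not orthogonal to \<open>\<alpha>\<close> or \<open>\<beta>\<close>, and then its sum with one of
  \<open>\<plusminus>\<alpha>, \<plusminus>\<beta>\<close> is such a short root, or it has product \<open>\<plusminus>1/2\<close> with \<open>\<eta>\<close>, which is not integral.\<close>

lemma semi_closed_obstruction:
  assumes semi: "semi_closed B \<epsilon> G" and missing: "\<not> short \<subseteq> G"
  obtains w where "\<And>x. x \<in> short \<Longrightarrow> B x w \<in> \<int>" "\<And>x. x \<in> G \<Longrightarrow> B x w / 2 \<in> \<int>"
    "\<exists>x\<in>short. B x w / 2 \<notin> \<int>"
proof -
  have G: "x \<in> F4" if "x \<in> G" for x
    using semi that unfolding semi_closed_def subroot_system_def by blast
  have neg: "- x \<in> G" if "x \<in> G" for x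
    using semi that G refl_root_self unfolding semi_closed_def subroot_system_def by metis
  have add: "x + y \<in> G" if "x \<in> G" "y \<in> G" "x + y \<in> short" for x y
    using semi that short_not_long unfolding semi_closed_def F4_iff by (metis Diff_iff F4_iff)
  obtain \<alpha>0 \<beta>0 where "\<alpha>0 \<in> G" "\<beta>0 \<in> G" "\<alpha>0 \<in> short" "\<beta>0 \<in> short" "\<alpha>0 + \<beta>0 \<in> long"
    using semi unfolding semi_closed_def root_closed_def by blast
  then have \<alpha>0: "\<alpha>0 \<in> G" "\<alpha>0 \<in> short" and \<beta>0: "\<beta>0 \<in> G" "\<beta>0 \<in> short" and orth0: "B \<alpha>0 \<beta>0 = 0"
    by (simp_all add: short_add)
  show thesis
  proof (cases "\<forall>\<gamma>\<in>G. \<gamma> \<in> short \<longrightarrow> B \<gamma> \<alpha>0 \<in> \<int>")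
    case True
    show thesis
    proof (rule that)
      show "B x (2 *\<^sub>R \<alpha>0) \<in> \<int>" if "x \<in> short" for x
        using B_hurwitz_half_integral[of x \<alpha>0] that \<alpha>0 by (simp add: short_hurwitz B_expand)
      show "B x (2 *\<^sub>R \<alpha>0) / 2 \<in> \<int>" if "x \<in> G" for x
        using True that G[OF that] B_long_hurwitz_integral[of x \<alpha>0] \<alpha>0
        by (auto simp: short_hurwitz B_expand F4_iff)
      obtain z where "z \<in> short" "B \<alpha>0 z \<notin> \<int>" using short_neighbour \<alpha>0 by blast
      then show "\<exists>x\<in>short. B x (2 *\<^sub>R \<alpha>0) / 2 \<notin> \<int>"
        by (auto simp: B_commute B_expand)
    qed
  next
    case False
    then obtain \<gamma>0 where \<gamma>0: "\<gamma>0 \<in> G" "\<gamma>0 \<in> short" "B \<gamma>0 \<alpha>0 \<notin> \<int>" by blast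
    \<comment> \<open>A missing root orthogonal to \<open>\<alpha>0\<close> becomes non-orthogonal, and stays missing, when a
      multiple \<open>\<plusminus>\<gamma>0\<close> is added.\<close>
    obtain \<eta> where \<eta>: "\<eta> \<in> short" "\<eta> \<notin> G" "B \<eta> \<alpha>0 \<notin> \<int>"
    proof -
      obtain \<eta>0 where \<eta>0: "\<eta>0 \<in> short" "\<eta>0 \<notin> G" using missing by blast
      show thesis
      proof (cases "B \<eta>0 \<alpha>0 \<in> \<int>")
        case False
        then show thesis using that \<eta>0 by blast
      next
        case True
        have "B \<eta>0 \<alpha>0 = 0"
        proof -
          have "\<eta>0 \<noteq> \<alpha>0" "\<eta>0 \<noteq> - \<alpha>0" using \<eta>0 \<alpha>0 neg by auto
          then have "B \<eta>0 \<alpha>0 \<noteq> 1" "B \<eta>0 \<alpha>0 \<noteq> -1"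
            using short_eqI[of \<eta>0 \<alpha>0] short_eqI[of \<eta>0 "- \<alpha>0"] \<eta>0 \<alpha>0
            by (auto simp: short_iff hurwitz_minus B_expand)
          then show ?thesis using B_short_short[of \<eta>0 \<alpha>0] True \<eta>0 \<alpha>0 half_not_Ints by metis
        qed
        then have "B \<gamma>0 \<eta>0 \<notin> \<int>"
          using orthogonal_short_parity[of \<eta>0 \<alpha>0 \<gamma>0] \<eta>0 \<alpha>0 \<gamma>0 by blast
        then consider "B \<eta>0 \<gamma>0 = 1/2" | "B \<eta>0 \<gamma>0 = -1/2"
          using B_short_short_odd[of \<gamma>0 \<eta>0] \<eta>0 \<gamma>0 by (auto simp: B_commute)
        then show thesis
        proof cases
          case 1
          then have "\<eta>0 - \<gamma>0 \<in> short" using \<eta>0 \<gamma>0 by (simp add: short_diff)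
          moreover have "\<eta>0 - \<gamma>0 \<notin> G" using add[of "\<eta>0 - \<gamma>0" \<gamma>0] \<eta>0 \<gamma>0 by auto
          moreover have "B (\<eta>0 - \<gamma>0) \<alpha>0 \<notin> \<int>"
            using \<open>B \<eta>0 \<alpha>0 = 0\<close> \<gamma>0(3) by (simp add: B_expand)
          ultimately show thesis by (rule that)
        next
          case 2
          then have "\<eta>0 + \<gamma>0 \<in> short" using \<eta>0 \<gamma>0 by (simp add: short_add)
          moreover have "\<eta>0 + \<gamma>0 \<notin> G" using add[of "\<eta>0 + \<gamma>0" "- \<gamma>0"] neg \<eta>0 \<gamma>0 by auto
          moreover have "B (\<eta>0 + \<gamma>0) \<alpha>0 \<notin> \<int>"
            using \<open>B \<eta>0 \<alpha>0 = 0\<close> \<gamma>0(3) by (simp add: B_expand)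
          ultimately show thesis by (rule that)
        qed
      qed
    qed
    have \<eta>\<beta>: "B \<eta> \<beta>0 \<notin> \<int>" using orthogonal_short_parity[OF \<alpha>0(2) \<beta>0(2) orth0 \<eta>(1)] \<eta>(3) by blast
    \<comment> \<open>Signs are chosen such that the products are those of the picture above.\<close>
    define \<alpha> where "\<alpha> = (if B \<eta> \<alpha>0 = 1/2 then \<alpha>0 else - \<alpha>0)"
    define \<beta> where "\<beta> = (if B \<eta> \<beta>0 = 1/2 then \<beta>0 else - \<beta>0)"
    have \<alpha>: "\<alpha> \<in> G" "\<alpha> \<in> short" "B \<eta> \<alpha> = 1/2"
      using \<alpha>0 neg short_minus B_short_short_odd[OF \<eta>(1) \<alpha>0(2) \<eta>(3)] by (auto simp: \<alpha>_def B_expand)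
    have \<beta>: "\<beta> \<in> G" "\<beta> \<in> short" "B \<eta> \<beta> = 1/2"
      using \<beta>0 neg short_minus B_short_short_odd[OF \<eta>(1) \<beta>0(2) \<eta>\<beta>] by (auto simp: \<beta>_def B_expand)
    have \<alpha>\<beta>: "B \<alpha> \<beta> = 0" using orth0 by (simp add: \<alpha>_def \<beta>_def B_expand)
    have "B \<gamma>0 \<alpha> \<notin> \<int>" using \<gamma>0 by (auto simp: \<alpha>_def B_expand)
    then have \<gamma>0\<alpha>: "B \<gamma>0 \<alpha> = 1/2 \<or> B \<gamma>0 \<alpha> = -1/2" and \<gamma>0\<beta>: "B \<gamma>0 \<beta> = 1/2 \<or> B \<gamma>0 \<beta> = -1/2"
      using orthogonal_short_parity[OF \<alpha>(2) \<beta>(2) \<alpha>\<beta> \<gamma>0(2)] B_short_short_odd \<gamma>0 \<alpha> \<beta> by blast+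
    have \<alpha>1: "B \<alpha> \<alpha> = 1" and \<beta>1: "B \<beta> \<beta> = 1" and \<eta>1: "B \<eta> \<eta> = 1" and \<gamma>01: "B \<gamma>0 \<gamma>0 = 1"
      using \<alpha> \<beta> \<eta> \<gamma>0 by (auto simp: short_iff)
    have comm: "B \<alpha> \<eta> = 1/2" "B \<beta> \<eta> = 1/2" "B \<beta> \<alpha> = 0"
      using \<alpha> \<beta> \<alpha>\<beta> by (simp_all add: B_commute)
    have "\<exists>\<gamma>\<in>G. \<gamma> \<in> short \<and> B \<gamma> \<alpha> = 1/2 \<and> B \<gamma> \<beta> = 1/2"
    proof -
      \<comment> \<open>If the products of \<open>\<gamma>0\<close> with \<open>\<alpha>\<close> and \<open>\<beta>\<close> have different signs, \<open>\<gamma>0\<close> is \<open>\<plusminus>x\<^sub>2 \<plusminus> x\<^sub>3\<close>,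
        and subtracting it from \<open>\<alpha>\<close> or \<open>\<beta>\<close> replaces \<open>x\<^sub>2\<close> by \<open>x\<^sub>1\<close>.\<close>
      have flip: ?thesis if "\<sigma> \<in> G" "\<sigma> \<in> short" "B \<gamma>0 \<sigma> = 1/2"
        "B (\<sigma> - \<gamma>0) \<alpha> = 1/2" "B (\<sigma> - \<gamma>0) \<beta> = 1/2" for \<sigma>
      proof -
        have "\<sigma> - \<gamma>0 \<in> short" using that \<gamma>0 by (simp add: short_diff B_commute)
        moreover from this have "\<sigma> - \<gamma>0 \<in> G" using add[of \<sigma> "- \<gamma>0"] that neg \<gamma>0 by simp
        ultimately show ?thesis using that by blast
      qed
      consider "B \<gamma>0 \<alpha> = 1/2" "B \<gamma>0 \<beta> = 1/2" | "B \<gamma>0 \<alpha> = -1/2" "B \<gamma>0 \<beta> = -1/2"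
        | "B \<gamma>0 \<alpha> = 1/2" "B \<gamma>0 \<beta> = -1/2" | "B \<gamma>0 \<alpha> = -1/2" "B \<gamma>0 \<beta> = 1/2"
        using \<gamma>0\<alpha> \<gamma>0\<beta> by blast
      then show ?thesis
      proof cases
        case 1
        then show ?thesis using \<gamma>0 by blast
      next
        case 2
        then show ?thesis using neg short_minus \<gamma>0 by (intro bexI[of _ "- \<gamma>0"]) (auto simp: B_expand)
      next
        case 3
        then show ?thesis using flip[of \<alpha>] \<alpha> \<alpha>\<beta> \<alpha>1 by (simp add: B_expand)
      next
        case 4
        then show ?thesis using flip[of \<beta>] \<beta> comm \<beta>1 by (simp add: B_expand)
      qed
    qed
    then obtain \<gamma> where \<gamma>: "\<gamma> \<in> G" "\<gamma> \<in> short" "B \<gamma> \<alpha> = 1/2" "B \<gamma> \<beta> = 1/2"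
      by blast
    have \<gamma>1: "B \<gamma> \<gamma> = 1" and comm': "B \<alpha> \<gamma> = 1/2" "B \<beta> \<gamma> = 1/2"
      using \<gamma> by (simp_all add: short_iff B_commute)
    note hur = \<alpha>(2)[THEN short_hurwitz] \<beta>(2)[THEN short_hurwitz] \<gamma>(2)[THEN short_hurwitz]
      \<eta>(1)[THEN short_hurwitz]
    note vals = \<alpha>1 \<beta>1 \<gamma>1 \<eta>1 \<alpha>(3) \<beta>(3) \<gamma>(3,4) comm comm' \<alpha>\<beta>
    have \<alpha>\<gamma>: "\<alpha> - \<gamma> \<in> short" using \<alpha> \<gamma> vals by (simp add: short_diff)
    have \<alpha>\<gamma>G: "\<alpha> - \<gamma> \<in> G" using add[of \<alpha> "- \<gamma>"] \<alpha>\<gamma> \<alpha> \<gamma> neg by simp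
    have \<eta>\<gamma>: "B \<eta> \<gamma> = 1/2"
    proof -
      have "B \<eta> \<gamma> \<noteq> 1"
        using short_eqI[of \<eta> \<gamma>] hur vals \<eta> \<gamma> by auto
      moreover have "B \<eta> \<gamma> \<noteq> -1"
        using short_eqI[of \<eta> "- \<gamma>"] hur vals \<eta> \<gamma> neg by (auto simp: hurwitz_minus B_expand)
      moreover have "B \<eta> \<gamma> \<noteq> 0"
      proof
        assume 0: "B \<eta> \<gamma> = 0"
        have "\<eta> = \<alpha> - \<gamma> + \<beta>"
          by (rule short_eqI) (use hur vals 0 in \<open>auto simp: hurwitz_add hurwitz_diff B_expand B_commute[of \<gamma> \<eta>]\<close>)
        moreover have "\<alpha> - \<gamma> + \<beta> \<in> G"
          using add[OF \<alpha>\<gamma>G \<beta>(1)] \<eta>(1) unfolding \<open>\<eta> = \<alpha> - \<gamma> + \<beta>\<close> by blast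
        ultimately show False using \<eta> by simp
      qed
      \<comment> \<open>For the product \<open>-1/2\<close> the vector below would have norm \<open>-1\<close>.\<close>
      moreover have "B \<eta> \<gamma> \<noteq> -1/2"
        using B_hurwitz_nonneg[of "\<eta> + \<gamma> - \<alpha> - \<beta>"] hur vals
        by (auto simp: hurwitz_add hurwitz_diff B_expand B_commute[of \<gamma> \<eta>])
      ultimately show ?thesis using B_short_short[OF \<eta>(1) \<gamma>(2)] by blast
    qed
    then have \<gamma>\<eta>: "B \<gamma> \<eta> = 1/2" by (simp add: B_commute)
    note vals = vals \<eta>\<gamma> \<gamma>\<eta>
    define \<mu> where "\<mu> = 2 *\<^sub>R \<eta> - \<alpha> - \<beta>"
    have "of_int 2 *\<^sub>R \<eta> \<in> hurwitz" by (intro hurwitz_of_int hur)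
    then have "\<mu> \<in> hurwitz" unfolding \<mu>_def by (intro hurwitz_diff hur) simp
    moreover have "B \<mu> \<mu> = 2" using vals by (simp add: \<mu>_def B_expand)
    ultimately have \<mu>: "\<mu> \<in> long" by (simp add: long_iff)
    have orth: "B \<alpha> \<mu> = 0" "B \<beta> \<mu> = 0" "B \<gamma> \<mu> = 0" "B \<eta> \<mu> = 1"
      using vals by (simp_all add: \<mu>_def B_expand)
    have not1: "B x \<mu> \<noteq> 1" if x: "x \<in> G" "x \<in> short" for x
    proof
      assume 1: "B x \<mu> = 1"
      then have x\<eta>: "B x \<eta> = (1 + B x \<alpha> + B x \<beta>) / 2" by (simp add: \<mu>_def B_expand)
      have xx: "B x x = 1" "x \<in> hurwitz" using x by (simp_all add: short_iff)
      have not_eq: "x \<noteq> s" "x \<noteq> - s" if "B s \<mu> = 0" for s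
        using that 1 by (auto simp: B_expand)
      have small: "B x s \<noteq> 1 \<and> B x s \<noteq> -1" if "s \<in> short" "B s \<mu> = 0" for s
        using short_eqI[of x s] short_eqI[of x "- s"] that xx not_eq
        by (auto simp: short_iff hurwitz_minus B_expand)
      have a: "B x \<alpha> = 0 \<or> B x \<alpha> = 1/2 \<or> B x \<alpha> = -1/2" 
        and b: "B x \<beta> = 0 \<or> B x \<beta> = 1/2 \<or> B x \<beta> = -1/2"
        using B_short_short[OF x(2) \<alpha>(2)] B_short_short[OF x(2) \<beta>(2)] small[OF \<alpha>(2)] small[OF \<beta>(2)] orth
        by auto
      have ab: "B x \<alpha> = 0 \<longleftrightarrow> B x \<beta> = 0"
        using orthogonal_short_parity[OF \<alpha>(2) \<beta>(2) \<alpha>\<beta> x(2)] a b half_not_Ints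
        by (metis Ints_0)
      have eq: False if "y \<in> G" "B y y = 1" "B \<eta> y = 1" for y
      proof -
        have "\<eta> = y"
          using short_eqI[of \<eta> y] that hur vals G F4_hurwitz by simp
        then show False using that \<eta> by simp
      qed
      have step: "x + s \<in> G" "x + s \<in> short" if "B x s = -1/2" "s \<in> G" "s \<in> short" "x \<in> G" "x \<in> short" for x s
        using short_add[of x s] add[of x s] that by auto
      have \<eta>x: "B \<eta> x = B x \<eta>" by (rule B_commute)
      consider "B x \<alpha> = 1/2" "B x \<beta> = 1/2" | "B x \<alpha> = -1/2" "B x \<beta> = -1/2"
        | "B x \<alpha> = 1/2" "B x \<beta> = -1/2" | "B x \<alpha> = -1/2" "B x \<beta> = 1/2"
        | "B x \<alpha> = 0" "B x \<beta> = 0" using a b ab by auto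
      then show False
      proof cases
        case 1
        then show False using eq[of x] x xx x\<eta> by (simp add: \<eta>x)
      next
        case 2
        have s: "x + \<alpha> \<in> G" "x + \<alpha> \<in> short" using step[OF 2(1)] \<alpha> x by blast+
        have "B (x + \<alpha>) \<beta> = -1/2" using 2 vals by (simp add: B_expand)
        then have "x + \<alpha> + \<beta> \<in> G" "x + \<alpha> + \<beta> \<in> short" using step[of "x + \<alpha>" \<beta>] s \<beta> by blast+
        then show False using eq[of "x + \<alpha> + \<beta>"] 2 vals x\<eta> by (simp add: B_expand \<eta>x short_iff)
      next
        case 3
        then have "x + \<beta> \<in> G" "x + \<beta> \<in> short" using step[OF 3(2)] \<beta> x by blast+
        then show False using eq[of "x + \<beta>"] 3 vals x\<eta> by (simp add: B_expand \<eta>x short_iff)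
      next
        case 4
        then have "x + \<alpha> \<in> G" "x + \<alpha> \<in> short" using step[OF 4(1)] \<alpha> x by blast+
        then show False using eq[of "x + \<alpha>"] 4 vals x\<eta> by (simp add: B_expand \<eta>x short_iff)
      next
        case 5
        \<comment> \<open>Here \<open>x = x\<^sub>4 \<plusminus> x\<^sub>3\<close>. That the product with \<open>\<gamma>\<close> is not 0 is a matter of dimension; it
          follows from parity, as \<open>\<alpha>\<close> and \<open>\<gamma> - \<eta> = x\<^sub>3 - x\<^sub>4\<close> are orthogonal short roots.\<close>
        have "\<gamma> - \<eta> \<in> short" "B \<alpha> (\<gamma> - \<eta>) = 0"
          using \<gamma> \<eta> vals by (simp_all add: short_diff B_expand)
        then have "B x (\<gamma> - \<eta>) \<in> \<int>"
          using orthogonal_short_parity[of \<alpha> "\<gamma> - \<eta>" x] \<alpha> x 5 by simp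
        then have "B x \<gamma> - 1/2 \<in> \<int>" using 5 x\<eta> by (simp add: B_expand)
        then have "B x \<gamma> \<noteq> 0" "B x \<gamma> \<noteq> 1" "B x \<gamma> \<noteq> -1"
          using half_not_Ints small[OF \<gamma>(2) orth(3)] by (metis diff_0 minus_divide_left, auto)
        then consider "B x \<gamma> = -1/2" | "B x \<gamma> = 1/2" using B_short_short[OF x(2) \<gamma>(2)] by blast
        then show False
        proof cases
          case 1
          then have "x + \<gamma> \<in> G" "x + \<gamma> \<in> short" using step[OF 1] \<gamma> x by blast+
          then show False using eq[of "x + \<gamma>"] 5 vals x\<eta> by (simp add: B_expand \<eta>x short_iff)
        next
          case 2
          then have "x + - \<gamma> \<in> G \<and> x + - \<gamma> \<in> short"
            using step[of x "- \<gamma>"] \<gamma> neg short_minus x by (simp add: B_expand)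
          then have s: "x - \<gamma> \<in> G" "x - \<gamma> \<in> short" by simp_all
          have "B (x - \<gamma>) \<alpha> = -1/2" using 5 vals by (simp add: B_expand)
          then have s: "x - \<gamma> + \<alpha> \<in> G" "x - \<gamma> + \<alpha> \<in> short" using step[of "x - \<gamma>" \<alpha>] s \<alpha> by blast+
          have "B (x - \<gamma> + \<alpha>) \<beta> = -1/2" using 5 vals by (simp add: B_expand)
          then have "x - \<gamma> + \<alpha> + \<beta> \<in> G" "x - \<gamma> + \<alpha> + \<beta> \<in> short"
            using step[of "x - \<gamma> + \<alpha>" \<beta>] s \<beta> by blast+
          then show False using eq[of "x - \<gamma> + \<alpha> + \<beta>"] 5 vals x\<eta> by (simp add: B_expand \<eta>x short_iff)
        qed
      qed
    qed
    have short0: "B x \<mu> = 0" if "x \<in> G" "x \<in> short" for x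
      using not1[OF that] not1[of "- x"] neg short_minus that B_long_short[OF \<mu>, of x]
      by (auto simp: B_expand B_commute)
    have long_even: "B x \<mu> / 2 \<in> \<int>" if x: "x \<in> G" "x \<in> long" for x
    proof (cases "B x \<mu> = 1 \<or> B x \<mu> = -1")
      case True
      have zero: "B x s = 0" if s: "s \<in> G" "s \<in> short" "B s \<mu> = 0" for s
      proof -
        have "B x t \<noteq> -1" if t: "t \<in> G" "t \<in> short" "B t \<mu> = 0" for t
        proof
          assume "B x t = -1"
          then have "x + t \<in> short" using x t by (simp add: long_short_add)
          then have "B (x + t) \<mu> = 0" using short0 add x t by blast
          then show False using True t by (auto simp: B_expand)
        qed
        from this[of s] this[of "- s"] show ?thesis
          using B_long_short[OF x(2) s(2)] s neg short_minus by (auto simp: B_expand)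
      qed
      have "B x \<alpha> = 0" "B x \<beta> = 0" using zero \<alpha> \<beta> orth by blast+
      then have "B x \<mu> = 2 * B x \<eta>" by (simp add: \<mu>_def B_expand)
      then show ?thesis using B_long_short[OF x(2) \<eta>(1)] True by auto
    next
      case False
      then show ?thesis using B_long_long[OF x(2) \<mu>] by auto
    qed
    show thesis
    proof (rule that[of \<mu>])
      show "B x \<mu> \<in> \<int>" if "x \<in> short" for x
        using B_long_hurwitz_integral(2)[OF \<mu>] that short_hurwitz by blast
      show "B x \<mu> / 2 \<in> \<int>" if "x \<in> G" for x
        using short0[OF that] long_even[OF that] G[OF that] by (auto simp: F4_iff)
      show "\<exists>x\<in>short. B x \<mu> / 2 \<notin> \<int>"
        using \<eta>(1) orth(4) half_not_Ints(1) by (intro bexI[of _ \<eta>]) auto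
    qed
  qed
qed

section \<open>Systems whose gradient contains all short roots\<close>

text \<open>The four vectors are a basis of \<open>L\<close>. Subtracting \<open>\<epsilon> 1\<close>, \<open>\<epsilon> 2\<close>, \<open>\<epsilon> 3\<close> flips three signs of the
  half sum, negation then reaches all half sums, and two of them add up to \<open>\<epsilon> 4\<close>.\<close>

lemma short_generated:
  assumes add: "\<And>x y. x \<in> T \<Longrightarrow> y \<in> T \<Longrightarrow> x + y \<in> short \<Longrightarrow> x + y \<in> T"
    and neg: "\<And>x. x \<in> T \<Longrightarrow> - x \<in> T"
    and gen: "\<epsilon> 1 \<in> T" "\<epsilon> 2 \<in> T" "\<epsilon> 3 \<in> T" "(1/2) *\<^sub>R (\<epsilon> 1 + \<epsilon> 2 + \<epsilon> 3 + \<epsilon> 4) \<in> T"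
  shows "short \<subseteq> T"
proof -
  define v where "v a b c d = (1/2) *\<^sub>R (a *\<^sub>R \<epsilon> 1 + b *\<^sub>R \<epsilon> 2 + c *\<^sub>R \<epsilon> 3 + d *\<^sub>R \<epsilon> 4)" for a b c d
  have v_short: "v a b c d \<in> short" if "{a, b, c, d} \<subseteq> {1, -1}" for a b c d
  proof -
    define l :: "4 \<Rightarrow> real" where "l i = (if i = 1 then a else if i = 2 then b else if i = 3 then c else d)" for i
    have "v a b c d = (1/2) *\<^sub>R (\<Sum>i\<in>UNIV. l i *\<^sub>R \<epsilon> i)"
      by (simp add: v_def l_def sum_4)
    moreover have "l i \<in> {1, -1}" for i using that by (simp add: l_def)
    ultimately show ?thesis using half_short by simp
  qed
  have flip: "v (-1) b c d = v 1 b c d + - \<epsilon> 1" "v a (-1) c d = v a 1 c d + - \<epsilon> 2"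
    "v a b (-1) d = v a b 1 d + - \<epsilon> 3" for a b c d
  proof -
    have half: "(1/2) *\<^sub>R ((-1) *\<^sub>R e + y) = (1/2) *\<^sub>R (1 *\<^sub>R e + y) + - e" for e y :: 'v
    proof -
      have "(1/2) *\<^sub>R (1 *\<^sub>R e + y) + - e = (1/2) *\<^sub>R y + ((1/2) *\<^sub>R e + (-1) *\<^sub>R e)"
        by (simp add: algebra_simps)
      also have "\<dots> = (1/2) *\<^sub>R y + (1/2 + -1) *\<^sub>R e" by (simp only: scaleR_left_distrib)
      also have "\<dots> = (1/2) *\<^sub>R ((-1) *\<^sub>R e + y)" by (simp add: algebra_simps)
      finally show ?thesis by simp
    qed
    show "v (-1) b c d = v 1 b c d + - \<epsilon> 1"
      using half[of "\<epsilon> 1" "b *\<^sub>R \<epsilon> 2 + c *\<^sub>R \<epsilon> 3 + d *\<^sub>R \<epsilon> 4"] by (simp add: v_def algebra_simps)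
    show "v a (-1) c d = v a 1 c d + - \<epsilon> 2"
      using half[of "\<epsilon> 2" "a *\<^sub>R \<epsilon> 1 + c *\<^sub>R \<epsilon> 3 + d *\<^sub>R \<epsilon> 4"] by (simp add: v_def algebra_simps)
    show "v a b (-1) d = v a b 1 d + - \<epsilon> 3"
      using half[of "\<epsilon> 3" "a *\<^sub>R \<epsilon> 1 + b *\<^sub>R \<epsilon> 2 + d *\<^sub>R \<epsilon> 4"] by (simp add: v_def algebra_simps)
  qed
  have flip_T: "v 1 b c d \<in> T \<Longrightarrow> v (-1) b c d \<in> T" "v b 1 c d \<in> T \<Longrightarrow> v b (-1) c d \<in> T"
    "v b c 1 d \<in> T \<Longrightarrow> v b c (-1) d \<in> T" if "{b, c, d} \<subseteq> {1, -1}" for b c d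
    using add[OF _ neg[OF gen(1)], of "v 1 b c d", folded flip(1)]
      add[OF _ neg[OF gen(2)], of "v b 1 c d", folded flip(2)]
      add[OF _ neg[OF gen(3)], of "v b c 1 d", folded flip(3)] v_short that by simp_all
  have "v 1 1 1 1 \<in> T" using gen(4) by (simp add: v_def)
  then have 1: "v a 1 1 1 \<in> T" if "a \<in> {1, -1}" for a using that flip_T(1) by auto
  then have 2: "v a b 1 1 \<in> T" if "a \<in> {1, -1}" "b \<in> {1, -1}" for a b using that flip_T(2) by auto
  then have 3: "v a b c 1 \<in> T" if "a \<in> {1, -1}" "b \<in> {1, -1}" "c \<in> {1, -1}" for a b c
    using that flip_T(3) by auto
  have v: "v a b c d \<in> T" if "a \<in> {1, -1}" "b \<in> {1, -1}" "c \<in> {1, -1}" "d \<in> {1, -1}" for a b c d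
  proof (cases "d = 1")
    case True
    then show ?thesis using 3 that by simp
  next
    case False
    have "v (-a) (-b) (-c) 1 \<in> T" using that by (intro 3) auto
    then have "- v (-a) (-b) (-c) 1 \<in> T" by (rule neg)
    moreover have "- v (-a) (-b) (-c) 1 = v a b c (-1)" by (simp add: v_def algebra_simps)
    ultimately show ?thesis using False that by simp
  qed
  have "\<epsilon> 4 = v (-1) (-1) 1 1 + v 1 1 (-1) 1"
    by (simp add: v_def algebra_simps flip: scaleR_left_distrib)
  then have "\<epsilon> 4 \<in> T" using add[of "v (-1) (-1) 1 1" "v 1 1 (-1) 1"] v frame_short[of 4] by simp
  then have \<epsilon>: "\<epsilon> i \<in> T" for i using gen exhaust_4[of i] by auto
  show ?thesis
  proof
    fix x assume "x \<in> short"
    then consider (unit) s i where "x = s *\<^sub>R \<epsilon> i" "s \<in> {1, -1}"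
      | (half) l where "x = (1/2) *\<^sub>R (\<Sum>i\<in>UNIV. l i *\<^sub>R \<epsilon> i)" "\<forall>i. l i \<in> {1, -1}"
      unfolding F4_short_def by blast
    then show "x \<in> T"
    proof cases
      case unit
      then show ?thesis using \<epsilon>[of i] neg[of "\<epsilon> i"] by auto
    next
      case half
      then have "x = v (l 1) (l 2) (l 3) (l 4)" by (simp add: v_def sum_4)
      then show ?thesis using v half by simp
    qed
  qed
qed

text \<open>The graph is that of \<open>x \<mapsto> (x, w)\<close> over the short roots, with values read off along \<open>\<delta>\<close>. Other
  shifts are measured relative to it.\<close>

definition contains_graph :: "'v \<Rightarrow> 'v set \<Rightarrow> bool" where
  "contains_graph w \<Psi> \<longleftrightarrow> (\<forall>x\<in>short. \<exists>n. B x w = of_int n \<and> aff x n \<in> \<Psi>)"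

lemma contains_graphE:
  assumes "contains_graph w \<Psi>" "x \<in> short"
  obtains n where "B x w = of_int n" "aff x n \<in> \<Psi>"
  using assms unfolding contains_graph_def by blast

lemma parity_roots_1_iff:
  assumes "x \<in> F4" "B x w = of_int n"
  shows "aff x r \<in> parity_roots w 1 \<longleftrightarrow> (x \<in> long \<longrightarrow> even r) \<and> even (n + r)"
proof -
  have "(B x w + of_int (1 * r)) / 2 = of_int (n + r) / 2" using assms by simp
  also have "\<dots> \<in> \<int> \<longleftrightarrow> even (n + r)" by (simp only: even_iff_half_Ints)
  finally show ?thesis
    using assms(1) short_not_long by (auto simp: aff_parity_roots_iff F4_hurwitz aff_E62_iff F4_iff)
qed

text \<open>Subtracting a short root of the graph from a long root that violates the parity condition
  leaves a short root that violates it.\<close>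

lemma odd_shift_short:
  assumes closed: "closed_subroot_system B \<Phi> \<Psi>" and graph: "contains_graph w \<Psi>"
    and not_sub: "\<not> \<Psi> \<subseteq> parity_roots w 1"
  obtains x n k where "x \<in> short" "B x w = of_int n" "odd k" "aff x (n + k) \<in> \<Psi>"
proof -
  obtain \<xi> where \<xi>: "\<xi> \<in> \<Psi>" "\<xi> \<notin> parity_roots w 1" using not_sub by blast
  have "\<Psi> \<subseteq> \<Phi>" using closed unfolding closed_subroot_system_def subroot_system_def by blast
  then obtain x r where x: "\<xi> = aff x r" "x \<in> F4" "x \<in> long \<Longrightarrow> even r" using \<xi> by (blast elim: E62_E)
  show thesis
  proof (cases "x \<in> short")
    case True
    then obtain n where n: "B x w = of_int n" "aff x n \<in> \<Psi>" using graph by (blast elim: contains_graphE)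
    then have "odd (n + r)" using \<xi> x parity_roots_1_iff[OF x(2) n(1)] by auto
    then have "odd (r - n)" by presburger
    moreover have "aff x (n + (r - n)) \<in> \<Psi>" using \<xi> x by simp
    ultimately show thesis using that True n by blast
  next
    case False
    then have "x \<in> long" using x by (simp add: F4_iff)
    then obtain a b where ab: "a \<in> short" "b \<in> short" "x = a + b" by (blast elim: long_split)
    obtain na where na: "B a w = of_int na" "aff a na \<in> \<Psi>" using graph ab(1) by (blast elim: contains_graphE)
    obtain nb where nb: "B b w = of_int nb" "aff b nb \<in> \<Psi>" using graph ab(2) by (blast elim: contains_graphE)
    have "B x w = of_int (na + nb)" using na nb ab by (simp add: B_expand)
    then have "odd (na + nb + r)" using \<xi> x parity_roots_1_iff[OF x(2), of w "na + nb"] by auto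
    then have "odd (r - na - nb)" by presburger
    moreover have "aff (- a) (- na) \<in> \<Psi>" using closed_minus closed na by blast
    then have "aff (x + - a) (r + - na) \<in> \<Psi>"
      using closed_add[OF closed, of x r "- a" "- na"] \<xi> x ab
      by (simp add: aff_E62_iff short_hurwitz)
    then have "aff b (nb + (r - na - nb)) \<in> \<Psi>" using ab by simp
    ultimately show thesis using that ab nb by blast
  qed
qed

text \<open>Adding a point of the graph over a short root moves a shift \<open>k\<close> relative to the graph to a
  neighbouring root without changing it.\<close>

lemma shift_spreads:
  assumes closed: "closed_subroot_system B \<Phi> \<Psi>" and graph: "contains_graph w \<Psi>"
    and x: "x \<in> short" "B x w = of_int n" "aff x (n + k) \<in> \<Psi>"
    and y: "y \<in> short" "B y w = of_int m"
  shows "aff y (m + k) \<in> \<Psi>"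
proof -
  define Q where "Q y \<longleftrightarrow> (\<forall>m. B y w = of_int m \<longrightarrow> aff y (m + k) \<in> \<Psi>)" for y
  have "Q y"
  proof (rule short_connected[OF x(1) y(1)])
    show "Q x" using x by (simp add: Q_def)
  next
    fix u v assume uv: "u \<in> short" "v \<in> short" "u + v \<in> short" "Q u"
    obtain nu where nu: "B u w = of_int nu" using graph uv(1) by (blast elim: contains_graphE)
    obtain nv where nv: "B v w = of_int nv" "aff v nv \<in> \<Psi>" using graph uv(2) by (blast elim: contains_graphE)
    have "aff u (nu + k) \<in> \<Psi>" using uv nu by (simp add: Q_def)
    then have "aff (u + v) (nu + k + nv) \<in> \<Psi>"
      using closed_add[OF closed, of u "nu + k" v nv] nv uv by (simp add: aff_E62_iff short_hurwitz)
    moreover have "B (u + v) w = of_int (nu + nv)" using nu nv by (simp add: B_expand)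
    ultimately show "Q (u + v)" by (auto simp: Q_def algebra_simps simp del: of_int_add)
  qed
  then show ?thesis using y by (simp add: Q_def)
qed

text \<open>A sum of two short roots of the system that is a long root has to have an even shift to be a root of
  \<open>\<Phi>\<close>. When shifts of both parities are available at the short roots, this can always be arranged.\<close>

lemma odd_shift_full_gradient:
  assumes closed: "closed_subroot_system B \<Phi> \<Psi>" and graph: "contains_graph w \<Psi>"
    and not_sub: "\<not> \<Psi> \<subseteq> parity_roots w 1"
  shows "F4 \<subseteq> gradient \<epsilon> \<delta> \<Psi>"
proof
  fix x assume x: "x \<in> F4"
  obtain z n k where z: "z \<in> short" "B z w = of_int n" "odd k" "aff z (n + k) \<in> \<Psi>"
    using odd_shift_short[OF assms] by blast
  show "x \<in> gradient \<epsilon> \<delta> \<Psi>"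
  proof (cases "x \<in> short")
    case True
    then show ?thesis using graph x by (auto simp: gradient_iff elim: contains_graphE)
  next
    case False
    then have long: "x \<in> long" using x by (simp add: F4_iff)
    then obtain a b where ab: "a \<in> short" "b \<in> short" "x = a + b" by (blast elim: long_split)
    obtain na where na: "B a w = of_int na" "aff a na \<in> \<Psi>" using graph ab(1) by (blast elim: contains_graphE)
    obtain nb where nb: "B b w = of_int nb" "aff b nb \<in> \<Psi>" using graph ab(2) by (blast elim: contains_graphE)
    have nb': "aff b (nb + k) \<in> \<Psi>" using shift_spreads[OF closed graph z(1,2,4) ab(2) nb(1)] .
    have "aff x (na + nb) \<in> \<Psi> \<or> aff x (na + (nb + k)) \<in> \<Psi>"
    proof (cases "even (na + nb)")
      case True
      then show ?thesis using closed_add[OF closed na(2) nb(2)] long ab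
        by (simp add: aff_E62_iff long_hurwitz)
    next
      case False
      then have "even (na + (nb + k))" using z(3) by presburger
      then show ?thesis using closed_add[OF closed na(2) nb'] long ab
        by (simp add: aff_E62_iff long_hurwitz)
    qed
    then show ?thesis using x by (auto simp: gradient_iff)
  qed
qed

text \<open>The shifts at the basis \<open>\<epsilon> 1\<close>, \<open>\<epsilon> 2\<close>, \<open>\<epsilon> 3\<close> and the half sum \<open>h\<close> can be chosen freely, and they
  determine \<open>w\<close>: its last coordinate is forced by \<open>2 h - \<epsilon> 1 - \<epsilon> 2 - \<epsilon> 3 = \<epsilon> 4\<close>.\<close>

lemma contains_graph_exists:
  assumes closed: "closed_subroot_system B \<Phi> \<Psi>" and short: "short \<subseteq> gradient \<epsilon> \<delta> \<Psi>"
  obtains w where "contains_graph w \<Psi>"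
proof -
  have "\<exists>r. aff x r \<in> \<Psi>" if "x \<in> short" for x using short that by (auto simp: gradient_iff)
  then obtain \<rho> where \<rho>: "\<And>x. x \<in> short \<Longrightarrow> aff x (\<rho> x) \<in> \<Psi>" by metis
  define h where "h = (1/2) *\<^sub>R (\<epsilon> 1 + \<epsilon> 2 + \<epsilon> 3 + \<epsilon> 4)"
  have h: "h \<in> short" using half_short[of "\<lambda>_. 1"] by (simp add: h_def sum_4)
  define w where "w = of_int (\<rho> (\<epsilon> 1)) *\<^sub>R \<epsilon> 1 + of_int (\<rho> (\<epsilon> 2)) *\<^sub>R \<epsilon> 2 + of_int (\<rho> (\<epsilon> 3)) *\<^sub>R \<epsilon> 3
    + of_int (2 * \<rho> h - \<rho> (\<epsilon> 1) - \<rho> (\<epsilon> 2) - \<rho> (\<epsilon> 3)) *\<^sub>R \<epsilon> 4"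
  have Bw: "B (\<epsilon> 1) w = \<rho> (\<epsilon> 1)" "B (\<epsilon> 2) w = \<rho> (\<epsilon> 2)" "B (\<epsilon> 3) w = \<rho> (\<epsilon> 3)"
    "B (\<epsilon> 4) w = of_int (2 * \<rho> h - \<rho> (\<epsilon> 1) - \<rho> (\<epsilon> 2) - \<rho> (\<epsilon> 3))"
    by (simp_all add: w_def B_expand B_frame)
  have "B h w = (B (\<epsilon> 1) w + B (\<epsilon> 2) w + B (\<epsilon> 3) w + B (\<epsilon> 4) w) / 2"
    by (simp add: h_def B_expand)
  then have Bh: "B h w = \<rho> h" by (simp add: Bw)
  define T where "T = {x \<in> short. \<exists>n. B x w = of_int n \<and> aff x n \<in> \<Psi>}"
  have "short \<subseteq> T"
  proof (rule short_generated)
    fix x y assume xy: "x \<in> T" "y \<in> T" "x + y \<in> short"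
    then obtain n m where n: "B x w = of_int n" "aff x n \<in> \<Psi>" and m: "B y w = of_int m" "aff y m \<in> \<Psi>"
      by (auto simp: T_def)
    have "aff (x + y) (n + m) \<in> \<Psi>"
      using closed_add[OF closed n(2) m(2)] xy by (simp add: aff_E62_iff short_hurwitz)
    moreover have "B (x + y) w = of_int (n + m)" using n m by (simp add: B_expand)
    ultimately show "x + y \<in> T" using xy unfolding T_def by blast
  next
    fix x assume x: "x \<in> T"
    then obtain n where n: "B x w = of_int n" "aff x n \<in> \<Psi>" by (auto simp: T_def)
    have "aff (- x) (- n) \<in> \<Psi>" using closed_minus closed n by blast
    moreover have "B (- x) w = of_int (- n)" using n by (simp add: B_expand)
    ultimately show "- x \<in> T" using x short_minus unfolding T_def by blast
  qed (use \<rho> frame_short h Bw(1-3) Bh in \<open>auto simp: T_def simp flip: h_def\<close>)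
  then have "contains_graph w \<Psi>" by (auto simp: contains_graph_def T_def)
  then show thesis by (rule that)
qed

lemma closed_full:
  assumes closed: "closed_subroot_system B \<Phi> \<Delta>" and short: "\<And>x r. x \<in> short \<Longrightarrow> aff x r \<in> \<Delta>"
  shows "\<Phi> \<subseteq> \<Delta>"
proof
  fix \<xi> assume \<xi>: "\<xi> \<in> \<Phi>"
  then obtain x r where x: "\<xi> = aff x r" "x \<in> F4" by (blast elim: E62_E)
  show "\<xi> \<in> \<Delta>"
  proof (cases "x \<in> short")
    case True
    then show ?thesis using x short by simp
  next
    case False
    then have "x \<in> long" using x by (simp add: F4_iff)
    then obtain a b where ab: "a \<in> short" "b \<in> short" "x = a + b" by (blast elim: long_split)
    then show ?thesis using closed_add[OF closed short[OF ab(1), of r] short[OF ab(2), of 0]] \<xi> x by simp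
  qed
qed

lemma parity_roots_contain_graph:
  assumes "\<And>x. x \<in> short \<Longrightarrow> B x w \<in> \<int>"
  shows "contains_graph w (parity_roots w 1)"
  unfolding contains_graph_def
proof
  fix x assume x: "x \<in> short"
  then obtain n where n: "B x w = of_int n" using assms by (auto elim: Ints_cases)
  moreover have "aff x n \<in> parity_roots w 1"
    using parity_roots_1_iff[OF _ n] x short_not_long by (simp add: F4_iff)
  ultimately show "\<exists>n. B x w = of_int n \<and> aff x n \<in> parity_roots w 1" by blast
qed

text \<open>A larger closed system has an odd shift \<open>k\<close> relative to the graph at every short root. Writing a
  short root as a sum of two short roots, one with shift \<open>k\<close> and one with an arbitrary even shift,
  gives all odd shifts; even shifts are in the smaller system anyway.\<close>

lemma parity_roots_maximal:
  assumes int: "\<And>x. x \<in> short \<Longrightarrow> B x w \<in> \<int>"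
  shows "maximal_closed_subroot_system B \<Phi> (parity_roots w 1)"
  unfolding maximal_closed_subroot_system_def
proof (intro conjI allI impI)
  note graph = parity_roots_contain_graph[OF int]
  obtain n where n: "B (\<epsilon> 1) w = of_int n" "aff (\<epsilon> 1) n \<in> parity_roots w 1"
    using graph frame_short by (blast elim: contains_graphE)
  then show "closed_subroot_system B \<Phi> (parity_roots w 1)" by (intro parity_roots_closed) auto
  have "aff (\<epsilon> 1) (n + 1) \<in> \<Phi>" using frame_short by (simp add: aff_E62_iff short_hurwitz)
  moreover have "aff (\<epsilon> 1) (n + 1) \<notin> parity_roots w 1"
    using n frame_short by (simp add: parity_roots_1_iff F4_iff)
  ultimately show "parity_roots w 1 \<noteq> \<Phi>" by blast
  fix \<Delta> assume \<Delta>: "closed_subroot_system B \<Phi> \<Delta> \<and> parity_roots w 1 \<subseteq> \<Delta> \<and> \<Delta> \<subset> \<Phi>"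
  then have closed: "closed_subroot_system B \<Phi> \<Delta>" and sub: "parity_roots w 1 \<subseteq> \<Delta>" by auto
  have m\<Delta>: "contains_graph w \<Delta>" using graph sub unfolding contains_graph_def by blast
  show "\<Delta> = parity_roots w 1"
  proof (rule ccontr)
    assume "\<Delta> \<noteq> parity_roots w 1"
    then have "\<not> \<Delta> \<subseteq> parity_roots w 1" using sub by blast
    then obtain z q k where z: "z \<in> short" "B z w = of_int q" "odd k" "aff z (q + k) \<in> \<Delta>"
      using odd_shift_short[OF closed m\<Delta>] by blast
    have all: "aff x r \<in> \<Delta>" if x: "x \<in> short" for x r
    proof -
      obtain y where y: "y \<in> short" "x - y \<in> short"
      proof -
        obtain y where y: "y \<in> short" "B x y \<notin> \<int>" using short_neighbour x by blast
        then consider "B x y = 1/2" | "B x y = -1/2" using B_short_short_odd x by blast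
        then show thesis
        proof cases
          case 1 then show thesis using that y x by (simp add: short_diff)
        next
          case 2 then show thesis using that[of "- y"] y x by (simp add: short_add short_minus)
        qed
      qed
      obtain ny where ny: "B y w = of_int ny" using graph y(1) by (blast elim: contains_graphE)
      obtain nz where nz: "B (x - y) w = of_int nz" using graph y(2) by (blast elim: contains_graphE)
      have y_k: "aff y (ny + k) \<in> \<Delta>" using shift_spreads[OF closed m\<Delta> z(1,2,4) y(1) ny] .
      have nx: "B x w = of_int (nz + ny)" using ny nz by (simp add: B_expand)
      show ?thesis
      proof (cases "even (nz + ny + r)")
        case True
        then have "aff x r \<in> parity_roots w 1"
          using parity_roots_1_iff[OF _ nx] x short_not_long by (simp add: F4_iff)
        then show ?thesis using sub by blast
      next
        case False
        then have "even (nz + (r - (ny + k)))" using z(3) by presburger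
        then have "aff (x - y) (r - (ny + k)) \<in> parity_roots w 1"
          using parity_roots_1_iff[OF _ nz] y short_not_long by (simp add: F4_iff)
        then have "aff (x - y) (r - (ny + k)) \<in> \<Delta>" using sub by blast
        then show ?thesis using closed_add[OF closed _ y_k, of "x - y" "r - (ny + k)"] x
          by (simp add: aff_E62_iff short_hurwitz)
      qed
    qed
    then have "\<Phi> \<subseteq> \<Delta>" using closed_full closed by blast
    then show False using \<Delta> by blast
  qed
qed

section \<open>Maximal systems with a semi-closed gradient\<close>

lemma parity_roots_0_iff:
  assumes "x \<in> F4"
  shows "aff x r \<in> parity_roots w 0 \<longleftrightarrow> aff x r \<in> \<Phi> \<and> B x w / 2 \<in> \<int>"
  using assms by (simp add: aff_parity_roots_iff F4_hurwitz)

text \<open>Otherwise \<open>\<Psi>\<close> would be the preimage of the roots that have even product with the vector \<open>w\<close> of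
  \<open>semi_closed_obstruction\<close>, and these form a closed subsystem of \<open>F\<^sub>4\<close>.\<close>

lemma maximal_semi_closed_short_gradient:
  assumes max: "maximal_closed_subroot_system B \<Phi> \<Psi>" and semi: "semi_closed B \<epsilon> (gradient \<epsilon> \<delta> \<Psi>)"
  shows "short \<subseteq> gradient \<epsilon> \<delta> \<Psi>"
proof (rule ccontr)
  assume "\<not> short \<subseteq> gradient \<epsilon> \<delta> \<Psi>"
  with semi obtain w where w: "\<And>x. x \<in> short \<Longrightarrow> B x w \<in> \<int>"
    "\<And>x. x \<in> gradient \<epsilon> \<delta> \<Psi> \<Longrightarrow> B x w / 2 \<in> \<int>" "\<exists>x\<in>short. B x w / 2 \<notin> \<int>"
    using semi_closed_obstruction by blast
  have \<Psi>: "\<Psi> \<subseteq> \<Phi>" "\<Psi> \<noteq> {}"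
    using max unfolding maximal_closed_subroot_system_def closed_subroot_system_def subroot_system_def by auto
  have sub: "\<Psi> \<subseteq> parity_roots w 0"
  proof
    fix \<xi> assume \<xi>: "\<xi> \<in> \<Psi>"
    then obtain x r where x: "\<xi> = aff x r" "x \<in> F4" using \<Psi> by (blast elim: E62_E)
    then have "x \<in> gradient \<epsilon> \<delta> \<Psi>" using \<xi> by (auto simp: gradient_iff)
    then show "\<xi> \<in> parity_roots w 0" using x \<xi> \<Psi> w(2) by (auto simp: parity_roots_0_iff)
  qed
  then have closed: "closed_subroot_system B \<Phi> (parity_roots w 0)"
    using \<Psi> by (intro parity_roots_closed) auto
  obtain x where x: "x \<in> short" "B x w / 2 \<notin> \<int>" using w(3) by blast
  then have "aff x 0 \<in> \<Phi>" "aff x 0 \<notin> parity_roots w 0"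
    by (simp_all add: aff_E62_iff short_hurwitz parity_roots_0_iff F4_iff)
  moreover have "parity_roots w 0 \<subseteq> \<Phi>" by (auto simp: parity_roots_def)
  ultimately have eq: "parity_roots w 0 = \<Psi>"
    using max closed sub unfolding maximal_closed_subroot_system_def by blast
  have "root_closed F4 (gradient \<epsilon> \<delta> \<Psi>)"
    unfolding root_closed_def
  proof (intro ballI impI)
    fix x y assume xy: "x \<in> gradient \<epsilon> \<delta> \<Psi>" "y \<in> gradient \<epsilon> \<delta> \<Psi>" "x + y \<in> F4"
    have "B (x + y) w / 2 = B x w / 2 + B y w / 2" by (simp add: B_expand add_divide_distrib)
    moreover have "B x w / 2 + B y w / 2 \<in> \<int>" using w(2) xy by (intro Ints_add)
    ultimately have "B (x + y) w / 2 \<in> \<int>" by metis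
    moreover have "aff (x + y) 0 \<in> \<Phi>" using xy(3) by (auto simp: aff_E62_iff F4_hurwitz F4_iff)
    ultimately have "aff (x + y) 0 \<in> parity_roots w 0" using xy(3) by (simp add: parity_roots_0_iff)
    then show "x + y \<in> gradient \<epsilon> \<delta> \<Psi>" using xy(3) eq by (auto simp: gradient_iff)
  qed
  then show False using semi by (simp add: semi_closed_def)
qed

lemma maximal_semi_closed_parity_roots:
  assumes max: "maximal_closed_subroot_system B \<Phi> \<Psi>" and semi: "semi_closed B \<epsilon> (gradient \<epsilon> \<delta> \<Psi>)"
    and proper: "gradient \<epsilon> \<delta> \<Psi> \<subset> F4"
  obtains w where "\<And>x. x \<in> short \<Longrightarrow> B x w \<in> \<int>" "\<Psi> = parity_roots w 1"
proof -
  have closed: "closed_subroot_system B \<Phi> \<Psi>" and ne: "\<Psi> \<noteq> \<Phi>" and \<Psi>: "\<Psi> \<subseteq> \<Phi>"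
    using max unfolding maximal_closed_subroot_system_def closed_subroot_system_def subroot_system_def by auto
  obtain w where w: "contains_graph w \<Psi>"
    using contains_graph_exists[OF closed maximal_semi_closed_short_gradient[OF max semi]] by blast
  have int: "B x w \<in> \<int>" if "x \<in> short" for x using contains_graphE[OF w that] by (metis Ints_of_int)
  have sub: "\<Psi> \<subseteq> parity_roots w 1" using odd_shift_full_gradient[OF closed w] proper by blast
  have "maximal_closed_subroot_system B \<Phi> (parity_roots w 1)" using int by (rule parity_roots_maximal)
  then have "closed_subroot_system B \<Phi> (parity_roots w 1)" "parity_roots w 1 \<subset> \<Phi>"
    unfolding maximal_closed_subroot_system_def by (auto simp: parity_roots_def)
  then have "parity_roots w 1 = \<Psi>" using max sub unfolding maximal_closed_subroot_system_def by blast
  then show thesis using that int by blast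
qed

lemma parity_roots_gradient_iff:
  assumes "\<And>x. x \<in> short \<Longrightarrow> B x w \<in> \<int>"
  shows "x \<in> gradient \<epsilon> \<delta> (parity_roots w 1) \<longleftrightarrow> x \<in> short \<or> x \<in> long \<and> B x w / 2 \<in> \<int>"
proof (cases "x \<in> short")
  case True
  then show ?thesis using parity_roots_contain_graph[OF assms]
    by (auto simp: gradient_iff F4_iff elim: contains_graphE)
next
  case False
  show ?thesis
  proof (cases "x \<in> long")
    case long: True
    have "(B x w + of_int (1 * r)) / 2 \<in> \<int> \<longleftrightarrow> B x w / 2 \<in> \<int>" if "even r" for r :: int
    proof -
      obtain k where "r = 2 * k" using \<open>even r\<close> by (rule evenE)
      then have "(B x w + of_int (1 * r)) / 2 = B x w / 2 + of_int k" by simp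
      then show ?thesis by (metis Ints_add Ints_diff Ints_of_int add_diff_cancel_right')
    qed
    moreover have "even (0 :: int)" by simp
    ultimately show ?thesis using long False
      by (auto simp: gradient_iff F4_iff aff_parity_roots_iff aff_E62_iff long_hurwitz)
  qed (simp add: False gradient_iff F4_iff)
qed

text \<open>A sum of two roots of the gradient leaves it only if it is a long root on which \<open>w\<close> is odd. Then the
  summands are short: two long ones have even products with \<open>w\<close>, and the sum of a long and
  a short root is not long.\<close>

lemma parity_roots_gradient:
  assumes int: "\<And>x. x \<in> short \<Longrightarrow> B x w \<in> \<int>" and odd: "\<exists>x\<in>long. B x w / 2 \<notin> \<int>"
  shows "gradient \<epsilon> \<delta> (parity_roots w 1) \<subset> F4" "semi_closed B \<epsilon> (gradient \<epsilon> \<delta> (parity_roots w 1))"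
proof -
  let ?G = "gradient \<epsilon> \<delta> (parity_roots w 1)"
  have G: "x \<in> ?G \<longleftrightarrow> x \<in> short \<or> x \<in> long \<and> B x w / 2 \<in> \<int>" for x
    using int by (rule parity_roots_gradient_iff)
  obtain \<mu> where \<mu>: "\<mu> \<in> long" "B \<mu> w / 2 \<notin> \<int>" using odd by blast
  then have notin: "\<mu> \<in> F4" "\<mu> \<notin> ?G" using short_not_long by (auto simp: G F4_iff)
  moreover have "?G \<subseteq> F4" by (auto simp: gradient_iff)
  ultimately show "?G \<subset> F4" by blast
  obtain a b where "a \<in> short" "b \<in> short" "\<mu> = a + b" using \<mu> by (blast elim: long_split)
  then have "\<not> root_closed F4 ?G" using notin unfolding root_closed_def by (metis G)
  moreover have "subroot_system B F4 ?G"
    using parity_roots_maximal[OF int] gradient_subroot_system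
    unfolding maximal_closed_subroot_system_def closed_subroot_system_def by blast
  moreover have "x \<in> short \<and> y \<in> short \<and> x + y \<in> long" if xy: "x \<in> ?G" "y \<in> ?G" "x + y \<in> F4 - ?G" for x y
  proof -
    have s: "x + y \<in> long" "B (x + y) w / 2 \<notin> \<int>" using xy by (auto simp: G F4_iff)
    have not_both: "\<not> (x \<in> long \<and> y \<in> long)"
    proof
      assume "x \<in> long \<and> y \<in> long"
      then have "B x w / 2 + B y w / 2 \<in> \<int>" using xy short_not_long unfolding G by (blast intro: Ints_add)
      then show False using s(2) by (simp add: B_expand add_divide_distrib)
    qed
    have "\<not> (x \<in> long \<and> y \<in> short)" "\<not> (x \<in> short \<and> y \<in> long)"
      using s(1) long_short_add(2)[of x y] long_short_add(2)[of y x] by (auto simp: add.commute)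
    then show ?thesis using xy s not_both by (auto simp: G)
  qed
  ultimately show "semi_closed B \<epsilon> ?G" unfolding semi_closed_def by blast
qed

section \<open>Linear functions on the short roots\<close>

lemma finite_short: "finite short"
proof -
  have "{s *\<^sub>R \<epsilon> i | s i. s \<in> {1, -1}} = (\<lambda>(s, i). s *\<^sub>R \<epsilon> i) ` ({1, -1} \<times> UNIV)" by auto
  moreover have "{(1/2) *\<^sub>R (\<Sum>i\<in>UNIV. l i *\<^sub>R \<epsilon> i) | l. \<forall>i. l i \<in> {1, -1}}
      = (\<lambda>l. (1/2) *\<^sub>R (\<Sum>i\<in>UNIV. l i *\<^sub>R \<epsilon> i)) ` (PiE UNIV (\<lambda>_. {1, -1}))"
    by (auto simp: PiE_UNIV_domain Pi_def)
  ultimately show ?thesis unfolding F4_short_def by (auto intro!: finite_PiE)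
qed

lemma short_in_lattice: "x \<in> short \<Longrightarrow> x \<in> int_lattice short"
proof -
  assume x: "x \<in> short"
  have "(\<Sum>\<alpha>\<in>short. of_int (if \<alpha> = x then 1 else 0) *\<^sub>R \<alpha>) = (\<Sum>\<alpha>\<in>short. if \<alpha> = x then \<alpha> else 0)"
    by (rule sum.cong) auto
  also have "\<dots> = x" using x finite_short by simp
  finally show ?thesis unfolding int_lattice_def
    by (intro CollectI exI[of _ "\<lambda>\<alpha>. if \<alpha> = x then 1 else 0"]) simp
qed

text \<open>The vector that represents a \<open>\<int>\<close>-linear function as a product.\<close>

definition weight :: "('v \<Rightarrow> int) \<Rightarrow> 'v" where
  "weight p = (\<Sum>i\<in>UNIV. of_int (p (\<epsilon> i)) *\<^sub>R \<epsilon> i)"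

lemma Z_linear_weight:
  assumes "Z_linear \<epsilon> p" "x \<in> short"
  shows "B x (weight p) = of_int (p x)"
proof -
  obtain h where h: "\<And>x y. x \<in> int_lattice short \<Longrightarrow> y \<in> int_lattice short \<Longrightarrow> h (x + y) = h x + h y"
    and p: "\<And>x. x \<in> short \<Longrightarrow> p x = h x"
    using assms(1) unfolding Z_linear_def by blast
  note mem = short_in_lattice int_lattice_add
  \<comment> \<open>The half sums are not integral combinations of \<open>\<epsilon>\<close>, so the value there is found from their
    doubles.\<close>
  have h0: "h 0 = 0"
    using h[of "\<epsilon> 1 + - \<epsilon> 1" "\<epsilon> 1 + - \<epsilon> 1"] mem frame_short short_minus
    by (metis add.right_inverse add_cancel_left_left)
  have neg: "h (- x) = - h x" if "x \<in> short" for x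
    using h[of x "- x"] mem short_minus that h0 by simp
  have sign: "real_of_int (h (s *\<^sub>R \<epsilon> i)) = s * of_int (h (\<epsilon> i))"
    "s *\<^sub>R \<epsilon> i \<in> int_lattice short" if "s \<in> {1, -1}" for s :: real and i
    using that neg mem short_minus frame_short by auto
  have B\<epsilon>: "B (\<epsilon> i) (weight p) = p (\<epsilon> i)" for i
    using exhaust_4[of i] by (auto simp: weight_def sum_4 B_expand B_frame)
  from assms(2) consider (unit) s i where "x = s *\<^sub>R \<epsilon> i" "s \<in> {1, -1}"
    | (half) l where "x = (1/2) *\<^sub>R (\<Sum>i\<in>UNIV. l i *\<^sub>R \<epsilon> i)" "\<forall>i. l i \<in> {1, -1}"
    unfolding F4_short_def by blast
  then show ?thesis
  proof cases
    case unit
    then show ?thesis using sign(1)[OF unit(2), of i] p[OF assms(2)] p[OF frame_short[of i]] B\<epsilon>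
      by (simp add: B_expand)
  next
    case half
    have l: "l i \<in> {1, -1}" for i using half by blast
    have "x + x = l 1 *\<^sub>R \<epsilon> 1 + l 2 *\<^sub>R \<epsilon> 2 + l 3 *\<^sub>R \<epsilon> 3 + l 4 *\<^sub>R \<epsilon> 4"
      unfolding half(1) sum_4 by (simp flip: scaleR_left_distrib)
    then have "h x + h x = h (l 1 *\<^sub>R \<epsilon> 1 + l 2 *\<^sub>R \<epsilon> 2 + l 3 *\<^sub>R \<epsilon> 3 + l 4 *\<^sub>R \<epsilon> 4)"
      using h mem assms(2) by metis
    also have "\<dots> = h (l 1 *\<^sub>R \<epsilon> 1) + h (l 2 *\<^sub>R \<epsilon> 2) + h (l 3 *\<^sub>R \<epsilon> 3) + h (l 4 *\<^sub>R \<epsilon> 4)"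
      by (simp only: h int_lattice_add sign(2)[OF l])
    finally have "2 * real_of_int (h x) = l 1 * h (\<epsilon> 1) + l 2 * h (\<epsilon> 2) + l 3 * h (\<epsilon> 3) + l 4 * h (\<epsilon> 4)"
      by (simp flip: sign(1)[OF l])
    moreover have "2 * B x (weight p) = l 1 * p (\<epsilon> 1) + l 2 * p (\<epsilon> 2) + l 3 * p (\<epsilon> 3) + l 4 * p (\<epsilon> 4)"
      by (simp add: half(1) sum_4 B_expand B\<epsilon>)
    ultimately show ?thesis using p assms(2) frame_short by simp
  qed
qed

lemma Z_linear_floor:
  assumes int: "\<And>x. x \<in> short \<Longrightarrow> B x w \<in> \<int>"
  shows "Z_linear \<epsilon> (\<lambda>x. \<lfloor>B x w\<rfloor>)"
proof -
  have "B x w \<in> \<int>" if "x \<in> int_lattice short" for x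
  proof -
    obtain n where n: "x = (\<Sum>\<alpha>\<in>short. of_int (n \<alpha>) *\<^sub>R \<alpha>)"
      using \<open>x \<in> _\<close> unfolding int_lattice_def by blast
    have "linear (\<lambda>x. B x w)" using bilinear_B by (simp add: bilinear_def)
    from linear_sum[OF this, of "\<lambda>\<alpha>. of_int (n \<alpha>) *\<^sub>R \<alpha>" short]
    have "B x w = (\<Sum>\<alpha>\<in>short. of_int (n \<alpha>) * B \<alpha> w)" by (simp add: n B_expand)
    also have "\<dots> \<in> \<int>" by (intro Ints_sum Ints_mult int) auto
    finally show ?thesis .
  qed
  then have "\<lfloor>B (x + y) w\<rfloor> = \<lfloor>B x w\<rfloor> + \<lfloor>B y w\<rfloor>"
    if "x \<in> int_lattice short" "y \<in> int_lattice short" for x y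
    using that by (auto simp: B_expand elim!: Ints_cases)
  then show ?thesis unfolding Z_linear_def by (intro exI[of _ "\<lambda>x. \<lfloor>B x w\<rfloor>"]) simp
qed

lemma long_weight:
  assumes p: "\<And>x. x \<in> short \<Longrightarrow> B x w = of_int (p x)" and st: "s \<in> {1, -1}" "t \<in> {1, -1}"
  obtains m where "B (s *\<^sub>R \<epsilon> i + t *\<^sub>R \<epsilon> j) w = of_int m" "even m \<longleftrightarrow> even (p (\<epsilon> i) + p (\<epsilon> j))"
proof
  show "B (s *\<^sub>R \<epsilon> i + t *\<^sub>R \<epsilon> j) w = of_int (\<lfloor>s\<rfloor> * p (\<epsilon> i) + \<lfloor>t\<rfloor> * p (\<epsilon> j))"
    using st p[OF frame_short] by (auto simp: B_expand)
  show "even (\<lfloor>s\<rfloor> * p (\<epsilon> i) + \<lfloor>t\<rfloor> * p (\<epsilon> j)) \<longleftrightarrow> even (p (\<epsilon> i) + p (\<epsilon> j))"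
    using st by auto
qed

lemma Psi_p_eq_parity_roots:
  assumes p: "\<And>x. x \<in> short \<Longrightarrow> B x w = of_int (p x)"
  shows "Psi_p \<epsilon> \<delta> p = parity_roots w 1"
proof (intro set_eqI iffI)
  fix \<xi> assume "\<xi> \<in> Psi_p \<epsilon> \<delta> p"
  then consider (short) x r where "\<xi> = aff x (p x + 2 * r)" "x \<in> short"
    | (long) s t i j r where "\<xi> = aff (s *\<^sub>R \<epsilon> i + t *\<^sub>R \<epsilon> j) (2 * r)" "s \<in> {1, -1}" "t \<in> {1, -1}" "i \<noteq> j"
        "even (p (\<epsilon> i) + p (\<epsilon> j))"
    unfolding Psi_p_def aff_def by blast
  then show "\<xi> \<in> parity_roots w 1"
  proof cases
    case short
    then show ?thesis using parity_roots_1_iff[OF _ p] short_not_long by (simp add: F4_iff)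
  next
    case long
    obtain m where "B (s *\<^sub>R \<epsilon> i + t *\<^sub>R \<epsilon> j) w = of_int m" "even m"
      using long_weight[OF p long(2,3)] long(5) by metis
    moreover have "s *\<^sub>R \<epsilon> i + t *\<^sub>R \<epsilon> j \<in> F4" using long unfolding F4_iff F4_long_def by blast
    ultimately show ?thesis using parity_roots_1_iff long(1) by simp
  qed
next
  fix \<xi> assume \<xi>: "\<xi> \<in> parity_roots w 1"
  then obtain x r where x: "\<xi> = aff x r" "x \<in> F4" by (auto simp: parity_roots_def)
  show "\<xi> \<in> Psi_p \<epsilon> \<delta> p"
  proof (cases "x \<in> short")
    case True
    then have "even (p x + r)" using parity_roots_1_iff[OF x(2) p] \<xi> x by simp
    then have "even (r - p x)" by presburger
    then obtain k where "r - p x = 2 * k" by (rule evenE)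
    then have "r = p x + 2 * k" by simp
    then show ?thesis unfolding Psi_p_def x(1) aff_def using True
      by (intro UnI1 CollectI exI[of _ x] exI[of _ k]) simp
  next
    case False
    then have "x \<in> long" using x by (simp add: F4_iff)
    then obtain s t i j where ij: "x = s *\<^sub>R \<epsilon> i + t *\<^sub>R \<epsilon> j" "s \<in> {1, -1}" "t \<in> {1, -1}" "i \<noteq> j"
      unfolding F4_long_def by blast
    obtain m where m: "B x w = of_int m" "even m \<longleftrightarrow> even (p (\<epsilon> i) + p (\<epsilon> j))"
      using long_weight[OF p ij(2,3)] ij(1) by metis
    then have "even r" "even m" using parity_roots_1_iff[OF x(2) m(1)] \<xi> x \<open>x \<in> long\<close> by auto
    moreover from \<open>even r\<close> obtain k where "r = 2 * k" by (rule evenE)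
    ultimately show ?thesis unfolding Psi_p_def x(1) aff_def using ij m(2)
      by (intro UnI2 CollectI exI[of _ s] exI[of _ t] exI[of _ i] exI[of _ j] exI[of _ k]) simp
  qed
qed

text \<open>The value at the half sum of \<open>\<epsilon>\<close> shows that the four values \<open>p (\<epsilon> i)\<close> have an even sum, so
  the number of even ones is 0, 2 or 4, and it is 2 if and only if two values have different parities.\<close>

lemma exactly_two_even_iff:
  assumes p: "\<And>x. x \<in> short \<Longrightarrow> B x w = of_int (p x)"
  shows "exactly_two_even \<epsilon> p \<longleftrightarrow> (\<exists>x\<in>long. B x w / 2 \<notin> \<int>)"
proof -
  define q where "q i = p (\<epsilon> i)" for i
  have "(\<exists>x\<in>long. B x w / 2 \<notin> \<int>) \<longleftrightarrow> (\<exists>i j. odd (q i + q j))"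
  proof
    assume "\<exists>x\<in>long. B x w / 2 \<notin> \<int>"
    then obtain s t i j where "s \<in> {1, -1}" "t \<in> {1, -1}" "B (s *\<^sub>R \<epsilon> i + t *\<^sub>R \<epsilon> j) w / 2 \<notin> \<int>"
      unfolding F4_long_def by blast
    then show "\<exists>i j. odd (q i + q j)" using long_weight[OF p] even_iff_half_Ints q_def by metis
  next
    assume "\<exists>i j. odd (q i + q j)"
    then obtain i j where ij: "odd (q i + q j)" by blast
    then have "i \<noteq> j" by auto
    then have "1 *\<^sub>R \<epsilon> i + 1 *\<^sub>R \<epsilon> j \<in> long" unfolding F4_long_def by blast
    moreover have "B (1 *\<^sub>R \<epsilon> i + 1 *\<^sub>R \<epsilon> j) w / 2 \<notin> \<int>"
      using long_weight[OF p, of 1 1 i j] even_iff_half_Ints q_def ij by (metis insertI1)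
    ultimately show "\<exists>x\<in>long. B x w / 2 \<notin> \<int>" by blast
  qed
  moreover have "even (q 1 + q 2 + q 3 + q 4)"
  proof -
    let ?h = "(1/2) *\<^sub>R (\<Sum>j\<in>UNIV. 1 *\<^sub>R \<epsilon> j)"
    have "?h \<in> short" by (rule half_short) simp
    then have "2 * B ?h w = 2 * of_int (p ?h)" using p by simp
    moreover have "2 * B ?h w = of_int (q 1 + q 2 + q 3 + q 4)"
      using p[OF frame_short] by (simp add: q_def sum_4 B_expand)
    ultimately have "real_of_int (q 1 + q 2 + q 3 + q 4) = of_int (2 * p ?h)" by simp
    then have "q 1 + q 2 + q 3 + q 4 = 2 * p ?h" by (simp only: of_int_eq_iff)
    then show ?thesis by simp
  qed
  moreover have "card {i. even (q i)} = (\<Sum>i\<in>UNIV. of_bool (even (q i)))"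
    by simp
  ultimately show ?thesis
    unfolding exactly_two_even_def q_def[symmetric] sum_4
    by (auto simp: of_bool_def forall_4 split: if_splits)
qed

section \<open>The type of \<open>\<Psi>\<^sub>p\<close>\<close>

text \<open>Roots that are not orthogonal lie in the same block. Every root is linked in this way to a
  point of the graph over a short root, and the short roots are connected.\<close>

lemma parity_roots_irreducible:
  assumes int: "\<And>x. x \<in> short \<Longrightarrow> B x w \<in> \<int>"
  shows "irreducible_roots B (parity_roots w 1)"
  unfolding irreducible_roots_def
proof (rule notI, elim exE conjE)
  note graph = parity_roots_contain_graph[OF int]
  fix \<Psi>1 \<Psi>2 assume \<Psi>: "\<Psi>1 \<noteq> {}" "\<Psi>2 \<noteq> {}" "\<Psi>1 \<inter> \<Psi>2 = {}"
    "parity_roots w 1 = \<Psi>1 \<union> \<Psi>2" "\<forall>\<alpha>\<in>\<Psi>1. \<forall>\<beta>\<in>\<Psi>2. B \<alpha> \<beta> = 0"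
  have block: "\<xi> \<in> \<Psi>1 \<longleftrightarrow> \<eta> \<in> \<Psi>1" if "\<xi> \<in> parity_roots w 1" "\<eta> \<in> parity_roots w 1" "B \<xi> \<eta> \<noteq> 0" for \<xi> \<eta>
    using that \<Psi> B_commute[of \<xi> \<eta>] by (metis UnE)
  define Q where "Q x \<longleftrightarrow> (\<forall>n. B x w = of_int n \<longrightarrow> aff x n \<in> \<Psi>1)" for x
  have link: "\<exists>x\<in>short. \<xi> \<in> \<Psi>1 \<longleftrightarrow> Q x" if \<xi>: "\<xi> \<in> parity_roots w 1" for \<xi>
  proof -
    obtain y r where y: "\<xi> = aff y r" "y \<in> F4" using \<xi> by (auto simp: parity_roots_def)
    obtain x where x: "x \<in> short" "B y x \<noteq> 0"
    proof (cases "y \<in> short")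
      case True
      then show thesis using that[of y] by (simp add: short_iff)
    next
      case False
      then have "y \<in> long" using y by (simp add: F4_iff)
      then obtain a b where "a \<in> short" "b \<in> short" "y = a + b" "B a b = 0" by (blast elim: long_split)
      then show thesis using that[of a] by (simp add: short_iff B_expand B_commute)
    qed
    obtain n where n: "B x w = of_int n" "aff x n \<in> parity_roots w 1" using graph x by (blast elim: contains_graphE)
    have "\<xi> \<in> \<Psi>1 \<longleftrightarrow> aff x n \<in> \<Psi>1" using block[OF \<xi> n(2)] x y by simp
    then have "\<xi> \<in> \<Psi>1 \<longleftrightarrow> Q x" using n(1) by (simp add: Q_def)
    then show ?thesis using x(1) by blast
  qed
  obtain \<xi> \<eta> where "\<xi> \<in> \<Psi>1" "\<eta> \<in> \<Psi>2" using \<Psi> by blast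
  moreover from this have "\<eta> \<notin> \<Psi>1" "\<xi> \<in> parity_roots w 1" "\<eta> \<in> parity_roots w 1" using \<Psi>(3,4) by auto
  ultimately obtain x y where xy: "x \<in> short" "Q x" "y \<in> short" "\<not> Q y"
    using link[of \<xi>] link[of \<eta>] by auto
  have "Q y"
  proof (rule short_connected[where Q = Q, OF xy(1,3,2)])
    fix u v assume uv: "u \<in> short" "v \<in> short" "u + v \<in> short" "Q u"
    obtain nu where nu: "B u w = of_int nu" "aff u nu \<in> parity_roots w 1"
      using graph uv(1) by (blast elim: contains_graphE)
    obtain n where n: "B (u + v) w = of_int n" "aff (u + v) n \<in> parity_roots w 1"
      using graph uv(3) by (blast elim: contains_graphE)
    have "B u v = -1/2" using uv by (simp add: short_add)
    then have "B u (u + v) = 1/2" using uv by (simp add: B_expand short_iff)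
    then have "aff u nu \<in> \<Psi>1 \<longleftrightarrow> aff (u + v) n \<in> \<Psi>1" using block[OF nu(2) n(2)] by simp
    then show "Q (u + v)" using uv nu n by (auto simp: Q_def)
  qed
  then show False using xy by simp
qed

lemma frame_expand:
  assumes "u \<in> span (range \<epsilon>)"
  shows "u = (\<Sum>m\<in>UNIV. B u (\<epsilon> m) *\<^sub>R \<epsilon> m)"
proof -
  have "linear (\<lambda>u. \<Sum>m\<in>UNIV. B u (\<epsilon> m) *\<^sub>R \<epsilon> m)"
    by (rule linearI) (simp_all add: B_expand sum.distrib scaleR_left_distrib scaleR_right.sum)
  then show ?thesis
    by (rule linear_eq_on_span[OF linear_ident _ _ assms])
       (auto simp: B_frame if_distrib[of "\<lambda>c. c *\<^sub>R _"] cong: if_cong)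
qed

lemma B_frame_expand:
  assumes "u \<in> span (range \<epsilon>)"
  shows "B v u = (\<Sum>m\<in>UNIV. B v (\<epsilon> m) * B u (\<epsilon> m))"
proof -
  have "linear (B v)" using bilinear_B by (simp add: bilinear_def)
  from linear_sum[OF this, of "\<lambda>m. B u (\<epsilon> m) *\<^sub>R \<epsilon> m" UNIV] show ?thesis
    unfolding frame_expand[OF assms, symmetric] by (simp add: B_expand mult.commute)
qed

lemma independent_frame: "independent (insert \<delta> (range \<epsilon>))"
proof -
  have "independent (range \<epsilon>)"
  proof (subst independent_explicit_finite_subsets, intro allI impI ballI)
    fix A u v assume A: "A \<subseteq> range \<epsilon>" "finite A" "(\<Sum>v\<in>A. u v *\<^sub>R v) = 0" "v \<in> A"
    have "linear (B v)" using bilinear_B by (simp add: bilinear_def)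
    from linear_sum[OF this, of "\<lambda>v. u v *\<^sub>R v" A] have zero: "(\<Sum>x\<in>A. u x * B v x) = 0"
      using A(3) by (simp add: B_expand)
    have ortho: "B v x = (if x = v then 1 else 0)" if "x \<in> A" for x
    proof -
      obtain a b where "v = \<epsilon> a" "x = \<epsilon> b" using A(1,4) \<open>x \<in> A\<close> by blast
      then show ?thesis using B_frame[of a b] B_frame[of a a] by (metis zero_neq_one)
    qed
    have "(\<Sum>x\<in>A. u x * B v x) = (\<Sum>x\<in>A. if x = v then u v else 0)"
      using ortho by (intro sum.cong) simp_all
    then show "u v = 0" using zero A by simp
  qed
  then show ?thesis using frame by (simp add: affine_frame_def independent_insert)
qed

text \<open>The space may be larger than the span of the frame and \<open>\<delta>\<close>, and \<open>B\<close> does not see \<open>\<delta>\<close>, so the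
  coefficient of \<open>\<delta>\<close> is obtained by extending a linear form.\<close>

lemma delta_coordinate:
  obtains g :: "'v \<Rightarrow> real" where "linear g" "g \<delta> = 1" "\<And>u. u \<in> span (range \<epsilon>) \<Longrightarrow> g u = 0"
proof -
  obtain g :: "'v \<Rightarrow> real" where g: "linear g" "\<forall>x\<in>insert \<delta> (range \<epsilon>). g x = (if x = \<delta> then 1 else 0)"
    using linear_independent_extend[OF independent_frame, of "\<lambda>x. if x = \<delta> then 1 else 0"] by blast
  have "\<delta> \<notin> range \<epsilon>" using frame span_base[of \<delta> "range \<epsilon>"] unfolding affine_frame_def by blast
  then have "g x = 0" if "x \<in> range \<epsilon>" for x using g(2) that by auto
  then have "g u = 0" if "u \<in> span (range \<epsilon>)" for u
    using linear_eq_0_on_span[OF g(1) _ that] by blast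
  then show thesis using that g by simp
qed

text \<open>For distinct indices, a similarity of ratio \<open>\<surd>2\<close> whose square is twice the identity. It takes the long roots
  \<open>\<plusminus>\<epsilon> i \<plusminus> \<epsilon> j\<close> and \<open>\<plusminus>\<epsilon> k \<plusminus> \<epsilon> l\<close> to \<open>\<plusminus>2\<epsilon> m\<close>.\<close>

definition fold_pairs :: "4 \<Rightarrow> 4 \<Rightarrow> 4 \<Rightarrow> 4 \<Rightarrow> 'v \<Rightarrow> 'v" where
  "fold_pairs i j k l v = B v (\<epsilon> i + \<epsilon> j) *\<^sub>R \<epsilon> i + B v (\<epsilon> i - \<epsilon> j) *\<^sub>R \<epsilon> j
     + B v (\<epsilon> k + \<epsilon> l) *\<^sub>R \<epsilon> k + B v (\<epsilon> k - \<epsilon> l) *\<^sub>R \<epsilon> l"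

lemma fold_pairs_linear: "linear (fold_pairs i j k l)"
  by (rule linearI) (simp_all add: fold_pairs_def B_expand algebra_simps)

lemma fold_pairs_span: "fold_pairs i j k l v \<in> span (range \<epsilon>)"
  unfolding fold_pairs_def by (intro span_add span_scale span_base) auto

lemma C4_roots_eq: "C4_roots \<epsilon> = long \<union> {(2 * s) *\<^sub>R \<epsilon> i | s i. s \<in> {1, -1}}"
  by (simp add: C4_roots_def F4_long_def)

context
  fixes i j k l :: 4
  assumes dist: "distinct [i, j, k, l]" and univ: "UNIV = {i, j, k, l}"
begin

lemma indices_neq:
  "i \<noteq> j" "i \<noteq> k" "i \<noteq> l" "j \<noteq> k" "j \<noteq> l" "k \<noteq> l"
  "j \<noteq> i" "k \<noteq> i" "l \<noteq> i" "k \<noteq> j" "l \<noteq> j" "l \<noteq> k"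
  using dist by auto

lemma B_fold_pairs:
  "B (fold_pairs i j k l v) (\<epsilon> i) = B v (\<epsilon> i) + B v (\<epsilon> j)"
  "B (fold_pairs i j k l v) (\<epsilon> j) = B v (\<epsilon> i) - B v (\<epsilon> j)"
  "B (fold_pairs i j k l v) (\<epsilon> k) = B v (\<epsilon> k) + B v (\<epsilon> l)"
  "B (fold_pairs i j k l v) (\<epsilon> l) = B v (\<epsilon> k) - B v (\<epsilon> l)"
  by (simp_all add: fold_pairs_def B_expand B_frame indices_neq)

lemma fold_pairs_twice:
  assumes "u \<in> span (range \<epsilon>)"
  shows "fold_pairs i j k l (fold_pairs i j k l u) = 2 *\<^sub>R u"
proof -
  have "fold_pairs i j k l (fold_pairs i j k l u) = (\<Sum>m\<in>UNIV. (2 * B u (\<epsilon> m)) *\<^sub>R \<epsilon> m)"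
    by (simp add: sum_distinct4[OF dist univ] fold_pairs_def[of i j k l "fold_pairs i j k l u"]
        B_expand B_fold_pairs)
  also have "\<dots> = 2 *\<^sub>R (\<Sum>m\<in>UNIV. B u (\<epsilon> m) *\<^sub>R \<epsilon> m)"
    by (simp add: scaleR_right.sum)
  finally show ?thesis unfolding frame_expand[OF assms, symmetric] .
qed

lemma fold_pairs_B:
  assumes "v \<in> span (range \<epsilon>)"
  shows "B (fold_pairs i j k l u) (fold_pairs i j k l v) = 2 * B u v"
  by (simp add: B_frame_expand[OF fold_pairs_span] B_frame_expand[OF assms]
      sum_distinct4[OF dist univ] B_fold_pairs algebra_simps)

text \<open>The sum and difference of coordinates of equal parity are even, so the image is in \<open>L\<close> again; its
  norm is 2.\<close>

lemma fold_pairs_short: "x \<in> short \<Longrightarrow> fold_pairs i j k l x \<in> long"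
proof -
  assume x: "x \<in> short"
  obtain n where n: "x = hur n" "\<And>i j. even (n i) = even (n j)"
    using short_hurwitz[OF x] by (blast elim: hurwitzE)
  define T where "T m = (if m = i then n i + n j else if m = j then n i - n j
    else if m = k then n k + n l else n k - n l)" for m
  have B: "B x (\<epsilon> m) = of_int (n m) / 2" for m
    using exhaust_4[of m] by (auto simp: n(1) hur_def sum_4 B_expand B_frame)
  have "fold_pairs i j k l x = hur T"
    by (simp add: fold_pairs_def hur_def sum_distinct4[OF dist univ] T_def B B_expand indices_neq
        scaleR_add_right add_divide_distrib diff_divide_distrib add.assoc)
  moreover have "even (T m)" for m using n(2) by (simp add: T_def)
  then have "hur T \<in> hurwitz" by (intro hurwitzI) simp
  moreover have "B (fold_pairs i j k l x) (fold_pairs i j k l x) = 2"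
    using x fold_pairs_B[OF hurwitz_span] by (simp add: short_iff)
  ultimately show ?thesis by (simp add: long_iff)
qed

lemma fold_pairs_frame:
  "fold_pairs i j k l (\<epsilon> i) = \<epsilon> i + \<epsilon> j" "fold_pairs i j k l (\<epsilon> j) = \<epsilon> i - \<epsilon> j"
  "fold_pairs i j k l (\<epsilon> k) = \<epsilon> k + \<epsilon> l" "fold_pairs i j k l (\<epsilon> l) = \<epsilon> k - \<epsilon> l"
  by (simp_all add: fold_pairs_def B_expand B_frame indices_neq)

text \<open>The map is twice its own inverse, so half the image of \<open>y\<close> is the candidate. It lies in \<open>L\<close> because
  the integral coordinates of a long root have an even sum.\<close>

lemma short_if_fold_pairs:
  assumes "y \<in> long"
  obtains x where "x \<in> short" "fold_pairs i j k l x = y"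
proof
  let ?x = "(1/2) *\<^sub>R fold_pairs i j k l y"
  obtain s t a b where y: "y = s *\<^sub>R \<epsilon> a + t *\<^sub>R \<epsilon> b" "s \<in> {1, -1}" "t \<in> {1, -1}" "a \<noteq> b"
    using assms(1) unfolding F4_long_def by blast
  define q where "q m = (if m = a then \<lfloor>s\<rfloor> else 0) + (if m = b then \<lfloor>t\<rfloor> else 0)" for m
  have "s = of_int \<lfloor>s\<rfloor>" "t = of_int \<lfloor>t\<rfloor>" using y by auto
  then have yq: "y = hur (\<lambda>m. 2 * q m)"
    using frame_pair_hur[OF y(4), of "\<lfloor>s\<rfloor>" "\<lfloor>t\<rfloor>"] y(1) by (simp add: q_def)
  have "(\<Sum>m\<in>UNIV. q m) = \<lfloor>s\<rfloor> + \<lfloor>t\<rfloor>" by (simp add: q_def sum.distrib)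
  then have even: "even (q i + (q j + (q k + q l)))"
    using y unfolding sum_distinct4[OF dist univ] by auto
  define T where "T m = (if m = i then q i + q j else if m = j then q i - q j
    else if m = k then q k + q l else q k - q l)" for m
  have B: "B y (\<epsilon> m) = of_int (q m)" for m
    using exhaust_4[of m] by (auto simp: yq hur_def sum_4 B_expand B_frame)
  have "?x = hur T"
    by (simp add: fold_pairs_def hur_def sum_distinct4[OF dist univ] T_def B B_expand indices_neq add.assoc)
  moreover have "even (T m) \<longleftrightarrow> even (q i + q j)" for m using even by (auto simp: T_def)
  then have "hur T \<in> hurwitz" by (intro hurwitzI) simp
  moreover have "B ?x ?x = 1"
    using assms fold_pairs_B[OF hurwitz_span] by (simp add: long_iff B_expand)
  ultimately show "?x \<in> short" by (simp add: short_iff)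
  show "fold_pairs i j k l ?x = y"
    using fold_pairs_twice[OF hurwitz_span] assms
    by (simp add: linear_scale[OF fold_pairs_linear] long_iff)
qed

context
  fixes w :: 'v
  assumes int: "\<And>x. x \<in> short \<Longrightarrow> B x w \<in> \<int>"
    and even_ij: "B (\<epsilon> i) w / 2 \<in> \<int>" "B (\<epsilon> j) w / 2 \<in> \<int>"
    and odd_kl: "B (\<epsilon> k) w / 2 \<notin> \<int>" "B (\<epsilon> l) w / 2 \<notin> \<int>"
begin

lemma frame_integers:
  obtains n where "\<And>m. B (\<epsilon> m) w = of_int (n m)" "even (n i)" "even (n j)" "odd (n k)" "odd (n l)"
proof -
  have "\<exists>n. B (\<epsilon> m) w = of_int n" for m using int[OF frame_short] by (auto elim: Ints_cases)
  then obtain n where "\<And>m. B (\<epsilon> m) w = of_int (n m)" by metis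
  then show thesis using that even_ij odd_kl by (simp add: even_iff_half_Ints)
qed

lemma long_even_cases:
  assumes "x \<in> long" "B x w / 2 \<in> \<int>"
  obtains s t where "s \<in> {1, -1}" "t \<in> {1, -1}"
      "x = s *\<^sub>R \<epsilon> i + t *\<^sub>R \<epsilon> j \<or> x = s *\<^sub>R \<epsilon> k + t *\<^sub>R \<epsilon> l"
proof -
  obtain n where n: "\<And>m. B (\<epsilon> m) w = of_int (n m)" "even (n i)" "even (n j)" "odd (n k)" "odd (n l)"
    using frame_integers by blast
  obtain s t a b where x: "x = s *\<^sub>R \<epsilon> a + t *\<^sub>R \<epsilon> b" "s \<in> {1, -1}" "t \<in> {1, -1}" "a \<noteq> b"
    using assms(1) unfolding F4_long_def by blast
  have "B x w = of_int (\<lfloor>s\<rfloor> * n a + \<lfloor>t\<rfloor> * n b)" using x by (auto simp: B_expand n(1))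
  then have "even (\<lfloor>s\<rfloor> * n a + \<lfloor>t\<rfloor> * n b)" using assms(2) even_iff_half_Ints by metis
  then have "even (n a + n b)" using x by auto
  moreover have "a \<in> {i, j, k, l}" "b \<in> {i, j, k, l}" using univ by blast+
  ultimately have "a = i \<and> b = j \<or> a = j \<and> b = i \<or> a = k \<and> b = l \<or> a = l \<and> b = k"
    using n x(4) by auto
  then show thesis using that[of s t] that[of t s] x by (auto simp: add.commute)
qed

lemma fold_pairs_long:
  assumes "x \<in> long" "B x w / 2 \<in> \<int>"
  obtains s m where "s \<in> {1, -1}" "fold_pairs i j k l x = (2 * s) *\<^sub>R \<epsilon> m"
proof -
  obtain s t where st: "s \<in> {1, -1}" "t \<in> {1, -1}"
      "x = s *\<^sub>R \<epsilon> i + t *\<^sub>R \<epsilon> j \<or> x = s *\<^sub>R \<epsilon> k + t *\<^sub>R \<epsilon> l"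
    using long_even_cases[OF assms] by blast
  have expand: "fold_pairs i j k l (s *\<^sub>R a + t *\<^sub>R b) = s *\<^sub>R fold_pairs i j k l a + t *\<^sub>R fold_pairs i j k l b" for a b
    by (simp add: linear_add[OF fold_pairs_linear] linear_scale[OF fold_pairs_linear])
  have eq: "fold_pairs i j k l x = (s + t) *\<^sub>R \<epsilon> i + (s - t) *\<^sub>R \<epsilon> j
    \<or> fold_pairs i j k l x = (s + t) *\<^sub>R \<epsilon> k + (s - t) *\<^sub>R \<epsilon> l"
    using st(3) by (auto simp: expand fold_pairs_frame algebra_simps)
  show thesis
  proof (cases "t = s")
    case True
    then have "fold_pairs i j k l x = (2 * s) *\<^sub>R \<epsilon> i \<or> fold_pairs i j k l x = (2 * s) *\<^sub>R \<epsilon> k"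
      using eq by simp
    then show thesis using that st(1) by blast
  next
    case False
    then have "t = - s" using st(1,2) by auto
    then have "fold_pairs i j k l x = (2 * s) *\<^sub>R \<epsilon> j \<or> fold_pairs i j k l x = (2 * s) *\<^sub>R \<epsilon> l"
      using eq by simp
    then show thesis using that st(1) by blast
  qed
qed

lemma double_frame_if_fold_pairs:
  assumes "s \<in> {1, -1}"
  obtains x where "x \<in> long" "B x w / 2 \<in> \<int>" "fold_pairs i j k l x = (2 * s) *\<^sub>R \<epsilon> m"
proof -
  obtain n where n: "\<And>m. B (\<epsilon> m) w = of_int (n m)" "even (n i)" "even (n j)" "odd (n k)" "odd (n l)"
    using frame_integers by blast
  define a b c where "a = (if m = i \<or> m = j then i else k)" and "b = (if m = i \<or> m = j then j else l)"
    and "c = (if m = i \<or> m = k then s else - s)"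
  have ab: "a \<noteq> b" using dist by (auto simp: a_def b_def)
  have c: "c \<in> {1, -1}" using assms by (auto simp: c_def)
  show thesis
  proof (rule that)
    show "s *\<^sub>R \<epsilon> a + c *\<^sub>R \<epsilon> b \<in> long" unfolding F4_long_def using ab c assms by blast
    have "B (s *\<^sub>R \<epsilon> a + c *\<^sub>R \<epsilon> b) w = of_int (\<lfloor>s\<rfloor> * n a + \<lfloor>c\<rfloor> * n b)"
      using assms c by (auto simp: B_expand n(1))
    moreover have "even (\<lfloor>s\<rfloor> * n a + \<lfloor>c\<rfloor> * n b)" using n assms c by (auto simp: a_def b_def)
    ultimately show "B (s *\<^sub>R \<epsilon> a + c *\<^sub>R \<epsilon> b) w / 2 \<in> \<int>" using even_iff_half_Ints by metis
    have "m \<in> {i, j, k, l}" using univ by blast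
    then show "fold_pairs i j k l (s *\<^sub>R \<epsilon> a + c *\<^sub>R \<epsilon> b) = (2 * s) *\<^sub>R \<epsilon> m"
      using indices_neq by (auto simp: linear_add[OF fold_pairs_linear] linear_scale[OF fold_pairs_linear]
          fold_pairs_frame a_def b_def c_def algebra_simps simp flip: scaleR_left_distrib)
  qed
qed

text \<open>On a root \<open>x + r\<delta>\<close> of the system, \<open>r\<close> and \<open>(x, w)\<close> have the same parity, so
  \<open>(r - (x, w)) / 2\<close> is an integer, and every integer occurs.\<close>

lemma parity_roots_type: "has_type B \<Phi> (parity_roots w 1) (C41_roots \<epsilon> \<delta>)"
proof -
  let ?K = "parity_roots w 1"
  obtain g :: "'v \<Rightarrow> real" where g: "linear g" "g \<delta> = 1" "\<And>u. u \<in> span (range \<epsilon>) \<Longrightarrow> g u = 0"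
    using delta_coordinate by blast
  define f where "f v = fold_pairs i j k l v + ((g v - B v w) / 2) *\<^sub>R \<delta>" for v
  have lin: "linear f"
    by (rule linearI) (simp_all add: f_def linear_add[OF fold_pairs_linear] linear_scale[OF fold_pairs_linear]
        linear_add[OF g(1)] linear_scale[OF g(1)] B_expand algebra_simps add_divide_distrib diff_divide_distrib)
  have fold_delta: "fold_pairs i j k l \<delta> = 0" by (simp add: fold_pairs_def)
  have f_span: "f (u + d *\<^sub>R \<delta>) = fold_pairs i j k l u + ((d - B u w) / 2) *\<^sub>R \<delta>"
    if "u \<in> span (range \<epsilon>)" for u d
    using that g by (simp add: f_def linear_add[OF fold_pairs_linear] linear_scale[OF fold_pairs_linear]
        linear_add[OF g(1)] linear_scale[OF g(1)] B_expand fold_delta)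
  have f_aff: "f (aff x r) = fold_pairs i j k l x + ((of_int r - B x w) / 2) *\<^sub>R \<delta>" if "x \<in> hurwitz" for x r
    using f_span[OF hurwitz_span[OF that]] by (simp add: aff_def)
  have K_int: "B x w \<in> \<int>" if "x \<in> F4" for x
  proof (cases "x \<in> short")
    case False
    then have "x \<in> long" using that by (simp add: F4_iff)
    then obtain a b where "a \<in> short" "b \<in> short" "x = a + b" by (blast elim: long_split)
    then show ?thesis using int by (simp add: B_expand)
  qed (rule int)
  have image: "f ` ?K = C41_roots \<epsilon> \<delta>"
  proof (intro equalityI subsetI)
    fix \<eta> assume "\<eta> \<in> f ` ?K"
    then obtain x r where x: "\<eta> = f (aff x r)" "x \<in> F4" "aff x r \<in> ?K" by (auto simp: parity_roots_def)
    obtain n where n: "B x w = of_int n" using K_int[OF x(2)] by (auto elim: Ints_cases)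
    have *: "x \<in> long \<longrightarrow> even r" "even (n + r)" using x parity_roots_1_iff[OF x(2) n] by auto
    then obtain s where "r - n = 2 * s" by (metis dvdE even_add even_diff)
    then have "real_of_int r - of_int n = 2 * of_int s" by linarith
    then have eta: "\<eta> = fold_pairs i j k l x + of_int s *\<^sub>R \<delta>" using x f_aff n F4_hurwitz by simp
    have "fold_pairs i j k l x \<in> C4_roots \<epsilon>"
    proof (cases "x \<in> short")
      case True
      then show ?thesis using fold_pairs_short by (simp add: C4_roots_eq)
    next
      case False
      then have "x \<in> long" "even n" using x * by (auto simp: F4_iff)
      then have "B x w / 2 \<in> \<int>" by (simp add: n flip: even_iff_half_Ints)
      then obtain c m where "c \<in> {1, -1}" "fold_pairs i j k l x = (2 * c) *\<^sub>R \<epsilon> m"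
        using fold_pairs_long[OF \<open>x \<in> long\<close>] by blast
      then show ?thesis unfolding C4_roots_eq by blast
    qed
    then show "\<eta> \<in> C41_roots \<epsilon> \<delta>" unfolding C41_roots_def eta by blast
  next
    fix \<eta> assume "\<eta> \<in> C41_roots \<epsilon> \<delta>"
    then obtain y s where y: "\<eta> = y + of_int s *\<^sub>R \<delta>" "y \<in> C4_roots \<epsilon>" unfolding C41_roots_def by blast
    have "\<exists>x\<in>F4. fold_pairs i j k l x = y \<and> (x \<in> long \<longrightarrow> B x w / 2 \<in> \<int>)"
    proof (cases "y \<in> long")
      case True
      then obtain x where "x \<in> short" "fold_pairs i j k l x = y" using short_if_fold_pairs by blast
      then show ?thesis using short_not_long by (auto simp: F4_iff)
    next
      case False
      then obtain c m where "y = (2 * c) *\<^sub>R \<epsilon> m" "c \<in> {1, -1}" using y unfolding C4_roots_eq by blast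
      then obtain x where "x \<in> long" "B x w / 2 \<in> \<int>" "fold_pairs i j k l x = y"
        using double_frame_if_fold_pairs by metis
      then show ?thesis by (auto simp: F4_iff)
    qed
    then obtain x where x: "x \<in> F4" "fold_pairs i j k l x = y" "x \<in> long \<Longrightarrow> B x w / 2 \<in> \<int>" by blast
    obtain n where n: "B x w = of_int n" using K_int[OF x(1)] by (auto elim: Ints_cases)
    have "x \<in> long \<longrightarrow> even n" using x(3) by (simp add: n even_iff_half_Ints)
    then have "aff x (n + 2 * s) \<in> ?K" using parity_roots_1_iff[OF x(1) n] by simp
    moreover have "f (aff x (n + 2 * s)) = \<eta>" using f_aff F4_hurwitz x y n by simp
    ultimately show "\<eta> \<in> f ` ?K" by blast
  qed
  have "?K \<subseteq> span (insert \<delta> (range \<epsilon>))"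
  proof
    fix \<xi> assume "\<xi> \<in> ?K"
    then obtain x r where x: "\<xi> = aff x r" "x \<in> F4" by (auto simp: parity_roots_def)
    have "x \<in> span (insert \<delta> (range \<epsilon>))"
      using hurwitz_span[OF F4_hurwitz[OF x(2)]] span_mono[of "range \<epsilon>"] by blast
    then show "\<xi> \<in> span (insert \<delta> (range \<epsilon>))"
      unfolding x aff_def by (intro span_add span_scale) (simp_all add: span_base)
  qed
  then have sub: "span ?K \<subseteq> span (insert \<delta> (range \<epsilon>))" by (rule span_minimal) (rule subspace_span)
  have "inj_on f (span (insert \<delta> (range \<epsilon>)))"
  proof (rule inj_onI)
    fix v v' assume v: "v \<in> span (insert \<delta> (range \<epsilon>))" "v' \<in> span (insert \<delta> (range \<epsilon>))" "f v = f v'"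
    obtain d d' where d: "v - d *\<^sub>R \<delta> \<in> span (range \<epsilon>)" "v' - d' *\<^sub>R \<delta> \<in> span (range \<epsilon>)"
      using v unfolding span_insert by blast
    define u u' where "u = v - d *\<^sub>R \<delta>" and "u' = v' - d' *\<^sub>R \<delta>"
    have u: "u \<in> span (range \<epsilon>)" "u' \<in> span (range \<epsilon>)" "v = u + d *\<^sub>R \<delta>" "v' = u' + d' *\<^sub>R \<delta>"
      using d by (simp_all add: u_def u'_def)
    have "fold_pairs i j k l u = fold_pairs i j k l u' \<and> (d - B u w) / 2 = (d' - B u' w) / 2"
      using v(3) by (intro span_delta_eq fold_pairs_span) (simp add: u f_span)
    moreover from this have "2 *\<^sub>R u = 2 *\<^sub>R u'" using fold_pairs_twice u by metis
    ultimately show "v = v'" using u by simp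
  qed
  then have "inj_on f (span ?K)" using sub inj_on_subset by blast
  then have "bij_betw f (span ?K) (span (C41_roots \<epsilon> \<delta>))"
    unfolding bij_betw_def by (simp flip: image add: linear_span_image[OF lin])
  moreover have "cartan_int B (f \<beta>) (f \<alpha>) = cartan_int B \<beta> \<alpha>" if "\<alpha> \<in> ?K" "\<beta> \<in> ?K" for \<alpha> \<beta>
  proof -
    obtain x r y s where xy: "\<alpha> = aff x r" "x \<in> F4" "\<beta> = aff y s" "y \<in> F4"
      using \<open>\<alpha> \<in> ?K\<close> \<open>\<beta> \<in> ?K\<close> by (auto simp: parity_roots_def)
    then show ?thesis
      using hurwitz_span[OF F4_hurwitz] by (simp add: cartan_int_def f_aff F4_hurwitz B_expand fold_pairs_B)
  qed
  moreover have "subroot_system B \<Phi> ?K"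
    using parity_roots_maximal[OF int]
    unfolding maximal_closed_subroot_system_def closed_subroot_system_def by blast
  ultimately show ?thesis
    unfolding has_type_def using parity_roots_irreducible[OF int] lin image by blast
qed

end
end

lemma Psi_p_type:
  assumes p: "Z_linear \<epsilon> p" and two: "exactly_two_even \<epsilon> p"
  shows "has_type B \<Phi> (Psi_p \<epsilon> \<delta> p) (C41_roots \<epsilon> \<delta>)"
proof -
  let ?E = "{m. even (p (\<epsilon> m))}"
  have "card ?E = 2" using two by (simp add: exactly_two_even_def)
  moreover from this have "card (- ?E) = 2" unfolding Compl_eq_Diff_UNIV by (subst card_Diff_subset) simp_all
  ultimately obtain i j k l where ij: "?E = {i, j}" "i \<noteq> j" and kl: "- ?E = {k, l}" "k \<noteq> l"
    by (auto simp: card_2_iff)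
  have dist: "distinct [i, j, k, l]" using ij kl by (simp, blast)
  have univ: "UNIV = {i, j, k, l}" using ij kl by blast
  note w = Z_linear_weight[OF p]
  have "i \<in> ?E" "j \<in> ?E" "k \<in> - ?E" "l \<in> - ?E" using ij kl by blast+
  then have "B (\<epsilon> i) (weight p) / 2 \<in> \<int>" "B (\<epsilon> j) (weight p) / 2 \<in> \<int>"
    "B (\<epsilon> k) (weight p) / 2 \<notin> \<int>" "B (\<epsilon> l) (weight p) / 2 \<notin> \<int>"
    unfolding w[OF frame_short] by (simp_all flip: even_iff_half_Ints)
  moreover have "B x (weight p) \<in> \<int>" if "x \<in> short" for x using w[OF that] by simp
  ultimately have "has_type B \<Phi> (parity_roots (weight p) 1) (C41_roots \<epsilon> \<delta>)"
    using parity_roots_type[OF dist univ] by blast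
  then show ?thesis using Psi_p_eq_parity_roots[OF w] by simp
qed

lemma maximal_semi_closed_iff_Psi_p:
  "maximal_closed_subroot_system B \<Phi> \<Psi> \<and> gradient \<epsilon> \<delta> \<Psi> \<subset> F4 \<and> semi_closed B \<epsilon> (gradient \<epsilon> \<delta> \<Psi>)
    \<longleftrightarrow> (\<exists>p. Z_linear \<epsilon> p \<and> exactly_two_even \<epsilon> p \<and> \<Psi> = Psi_p \<epsilon> \<delta> p)"
proof
  assume \<Psi>: "maximal_closed_subroot_system B \<Phi> \<Psi> \<and> gradient \<epsilon> \<delta> \<Psi> \<subset> F4
    \<and> semi_closed B \<epsilon> (gradient \<epsilon> \<delta> \<Psi>)"
  then obtain w where w: "\<And>x. x \<in> short \<Longrightarrow> B x w \<in> \<int>" "\<Psi> = parity_roots w 1"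
    using maximal_semi_closed_parity_roots by blast
  define p where "p x = \<lfloor>B x w\<rfloor>" for x
  have p: "B x w = of_int (p x)" if "x \<in> short" for x
    using w(1)[OF that] unfolding p_def by (metis Ints_cases floor_of_int)
  have "\<exists>x\<in>long. B x w / 2 \<notin> \<int>"
  proof (rule ccontr)
    assume "\<not> ?thesis"
    then have "F4 \<subseteq> gradient \<epsilon> \<delta> \<Psi>"
      unfolding w(2) using parity_roots_gradient_iff[OF w(1)] by (auto simp: F4_iff)
    then show False using \<Psi> by blast
  qed
  then have "exactly_two_even \<epsilon> p" using exactly_two_even_iff[OF p] by blast
  moreover have "Z_linear \<epsilon> p" using Z_linear_floor[OF w(1)] by (simp add: p_def[abs_def])
  moreover have "\<Psi> = Psi_p \<epsilon> \<delta> p" using Psi_p_eq_parity_roots[OF p] w(2) by simp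
  ultimately show "\<exists>p. Z_linear \<epsilon> p \<and> exactly_two_even \<epsilon> p \<and> \<Psi> = Psi_p \<epsilon> \<delta> p" by blast
next
  assume "\<exists>p. Z_linear \<epsilon> p \<and> exactly_two_even \<epsilon> p \<and> \<Psi> = Psi_p \<epsilon> \<delta> p"
  then obtain p where p: "Z_linear \<epsilon> p" "exactly_two_even \<epsilon> p" "\<Psi> = Psi_p \<epsilon> \<delta> p" by blast
  note w = Z_linear_weight[OF p(1)]
  have int: "B x (weight p) \<in> \<int>" if "x \<in> short" for x using w[OF that] by simp
  have "\<Psi> = parity_roots (weight p) 1" using Psi_p_eq_parity_roots[OF w] p(3) by simp
  moreover have "\<exists>x\<in>long. B x (weight p) / 2 \<notin> \<int>" using exactly_two_even_iff[OF w] p(2) by blast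
  ultimately show "maximal_closed_subroot_system B \<Phi> \<Psi> \<and> gradient \<epsilon> \<delta> \<Psi> \<subset> F4
    \<and> semi_closed B \<epsilon> (gradient \<epsilon> \<delta> \<Psi>)"
    using parity_roots_maximal[OF int] parity_roots_gradient[OF int] by blast
qed

end

theorem proposition9p1p3:
  fixes B :: "'v::real_vector \<Rightarrow> 'v \<Rightarrow> real" and \<epsilon> :: "4 \<Rightarrow> 'v" and \<delta> :: 'v
  assumes "affine_frame B \<epsilon> \<delta>"
  shows "(\<forall>\<Psi>. \<Psi> \<subseteq> E62_roots \<epsilon> \<delta> \<longrightarrow>
            (maximal_closed_subroot_system B (E62_roots \<epsilon> \<delta>) \<Psi> \<and>
             gradient \<epsilon> \<delta> \<Psi> \<subset> F4_roots \<epsilon> \<and> semi_closed B \<epsilon> (gradient \<epsilon> \<delta> \<Psi>)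
             \<longleftrightarrow>
             (\<exists>p. Z_linear \<epsilon> p \<and> exactly_two_even \<epsilon> p \<and> \<Psi> = Psi_p \<epsilon> \<delta> p))) \<and>
         (\<forall>p. Z_linear \<epsilon> p \<and> exactly_two_even \<epsilon> p \<longrightarrow>
            has_type B (E62_roots \<epsilon> \<delta>) (Psi_p \<epsilon> \<delta> p) (C41_roots \<epsilon> \<delta>))"
proof -
  interpret f4_frame B \<epsilon> \<delta> by unfold_locales (rule assms)
  show ?thesis by (intro conjI allI impI maximal_semi_closed_iff_Psi_p) (elim conjE, rule Psi_p_type)
qed

end
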